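(* Let $\mathcal{K}$ be a field with a nonarchimedean valuation that has a splitting and an infinite residue field. For every positive integer $n$, \[ \nu(\mathrm{Gr}_{\mathcal{K}}(n,2n))\cap\mathcal{L}_n \;=\; \nu(\mathrm{Fl}_{\mathcal{K}}(n))\cap \mathrm{SUBMOD}_n . \] If moreover $\mathcal{K}$ is algebraically closed or real closed, then \[ \operatorname{trop}(\mathrm{Gr}_{\mathcal{K}}(n,2n))\cap\mathcal{L}_n \;=\; \operatorname{trop}(\mathrm{Fl}_{\mathcal{K}}(n))\cap \mathrm{SUBMOD}_n . \] Here $\mathcal{L}_n$ is identified with $\mathbb{R}^{2^{[n]}}$ via $\phi$.
   Context: The valuation is nontrivial, $\mathrm{val}:\mathcal{K}^*\to\mathbb{R}$, and $\nu=-\mathrm{val}$. A splitting is a group homomorphism $\varphi:\Gamma\to\mathcal{K}^*$ from the value group $\Gamma=\mathrm{val}(\mathcal{K}^* )$ with $\mathrm{val}\circ\varphi=\mathrm{id}$. For $X\subseteq\mathcal{K}^N$, $\nu(X)=\{(\nu(x_i))_i : x\in X, \text{ all } x_i\ne0\}$, and $\operatorname{trop}(X)$ is the Euclidean closure of $\nu(X)$ (for real closed $\mathcal{K}$ the valuation is assumed compatible with the order). $\mathrm{Gr}_{\mathcal{K}}(n,2n)\subseteq\mathcal{K}^{\binom{[2n]}{n}}$ is the set of vectors of maximal minors $(\det M(C))_{C\in\binom{[2n]}{n}}$ of matrices $M\in\mathcal{K}^{n\times 2n}$. The affine flag variety $\mathrm{Fl}_{\mathcal{K}}(n)\subseteq\mathcal{K}^{2^{[n]}}$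 consists of the $(q_S)_{S\subseteq[n]}$ for which there is a complete flag $\{0\}=L_0\subset L_1\subset\cdots\subset L_n=\mathcal{K}^n$ ($\dim L_k=k$) and nonzero scalars $c_k$ with $(q_S)_{|S|=k}=c_k\cdot$(Plücker vector of $L_k$) for each $k=0,\dots,n$; the Plücker vector of $L_k$ is $(\det M_k(S))_{|S|=k}$ for a $k\times n$ matrix $M_k$ with row span $L_k$. $\mathrm{SUBMOD}_n$: submodular functions $F:2^{[n]}\to\mathbb{R}$, i.e. $F(S\cap T)+F(S\cup T)\le F(S)+F(T)$. $\mathcal{L}_n=\{p\in\mathbb{R}^{\binom{[2n]}{n}} : p(C)=p(D)\text{ whenever } C\cap[n]=D\cap[n]\}$, identified with $\mathbb{R}^{2^{[n]}}$ via $\phi(p)(S)=p(S\cup T)$ for any $T\subseteq\{n+1,\dots,2n\}$ with $|T|=n-|S|$. *)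

theory Defs
  imports "HOL-Analysis.Analysis" "HOL-Computational_Algebra.Polynomial"
begin

text \<open>A nontrivial nonarchimedean real valuation on the nonzero elements of a field
  (the values of val at 0 are irrelevant).\<close>
definition valuation :: "('a::field \<Rightarrow> real) \<Rightarrow> bool" where
  "valuation val \<longleftrightarrow>
     (\<forall>x y. x \<noteq> 0 \<longrightarrow> y \<noteq> 0 \<longrightarrow> val (x * y) = val x + val y) \<and>
     (\<forall>x y. x \<noteq> 0 \<longrightarrow> y \<noteq> 0 \<longrightarrow> x + y \<noteq> 0 \<longrightarrow> val (x + y) \<ge> min (val x) (val y)) \<and>
     (\<exists>x. x \<noteq> 0 \<and> val x \<noteq> 0)"

definition value_group :: "('a::field \<Rightarrow> real) \<Rightarrow> real set" where
  "value_group val = val ` {x. x \<noteq> 0}"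

definition has_splitting :: "('a::field \<Rightarrow> real) \<Rightarrow> bool" where
  "has_splitting val \<longleftrightarrow> (\<exists>spl :: real \<Rightarrow> 'a.
     (\<forall>g\<in>value_group val. spl g \<noteq> 0 \<and> val (spl g) = g) \<and>
     (\<forall>g\<in>value_group val. \<forall>h\<in>value_group val. spl (g + h) = spl g * spl h))"

definition val_ring :: "('a::field \<Rightarrow> real) \<Rightarrow> 'a set" where
  "val_ring val = {x. x = 0 \<or> val x \<ge> 0}"

definition val_ideal :: "('a::field \<Rightarrow> real) \<Rightarrow> 'a set" where
  "val_ideal val = {x. x = 0 \<or> val x > 0}"

definition residue_field :: "('a::field \<Rightarrow> real) \<Rightarrow> 'a set set" where
  "residue_field val = (\<lambda>x. {y \<in> val_ring val. x - y \<in> val_ideal val}) ` val_ring val"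

definition alg_closed :: "'a::field itself \<Rightarrow> bool" where
  "alg_closed _ \<longleftrightarrow> (\<forall>p :: 'a poly. degree p > 0 \<longrightarrow> (\<exists>x. poly p x = 0))"

definition field_order :: "('a::field \<Rightarrow> 'a \<Rightarrow> bool) \<Rightarrow> bool" where
  "field_order le \<longleftrightarrow>
     (\<forall>x. le x x) \<and> (\<forall>x y z. le x y \<longrightarrow> le y z \<longrightarrow> le x z) \<and>
     (\<forall>x y. le x y \<longrightarrow> le y x \<longrightarrow> x = y) \<and> (\<forall>x y. le x y \<or> le y x) \<and>
     (\<forall>x y z. le x y \<longrightarrow> le (x + z) (y + z)) \<and>
     (\<forall>x y. le 0 x \<longrightarrow> le 0 y \<longrightarrow> le 0 (x * y))"

definition real_closed_wrt :: "('a::field \<Rightarrow> 'a \<Rightarrow> bool) \<Rightarrow> bool" where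
  "real_closed_wrt le \<longleftrightarrow> field_order le \<and>
     (\<forall>x. le 0 x \<longrightarrow> (\<exists>y. y * y = x)) \<and>
     (\<forall>p :: 'a poly. odd (degree p) \<longrightarrow> (\<exists>x. poly p x = 0))"

definition val_order_compatible :: "('a::field \<Rightarrow> 'a \<Rightarrow> bool) \<Rightarrow> ('a \<Rightarrow> real) \<Rightarrow> bool" where
  "val_order_compatible le val \<longleftrightarrow>
     (\<forall>x y. le 0 x \<longrightarrow> le x y \<longrightarrow> y \<in> val_ring val \<longrightarrow> x \<in> val_ring val)"

text \<open>Indices are 0-based: [n] = {0..<n}, [2n] = {0..<2n}.
  Matrices are functions M i j (row i, column j).
  minor k M S: determinant (Leibniz formula) of the k x k submatrix of the first k rows
  and the columns in S (taken in increasing order), card S = k.\<close>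
definition minor :: "nat \<Rightarrow> (nat \<Rightarrow> nat \<Rightarrow> 'a::field) \<Rightarrow> nat set \<Rightarrow> 'a" where
  "minor k M S = (\<Sum>p | p permutes {..<k}.
      of_int (sign p) * (\<Prod>i<k. M i (sorted_list_of_set S ! p i)))"

definition Gr_idx :: "nat \<Rightarrow> nat set set" where
  "Gr_idx n = {C. C \<subseteq> {0..<2*n} \<and> card C = n}"

text \<open>Points of K^I are represented as functions nat set \<Rightarrow> K which vanish outside I.\<close>
definition Gr :: "nat \<Rightarrow> (nat set \<Rightarrow> 'a::field) set" where
  "Gr n = {x. \<exists>M :: nat \<Rightarrow> nat \<Rightarrow> 'a.
             x = (\<lambda>C. if C \<in> Gr_idx n then minor n M C else 0)}"

definition row_span :: "nat \<Rightarrow> nat \<Rightarrow> (nat \<Rightarrow> nat \<Rightarrow> 'a::field) \<Rightarrow> (nat \<Rightarrow> 'a) set" where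
  "row_span k m M = {v. \<exists>c. v = (\<lambda>j. if j < m then (\<Sum>i<k. c i * M i j) else 0)}"

definition rows_indep :: "nat \<Rightarrow> nat \<Rightarrow> (nat \<Rightarrow> nat \<Rightarrow> 'a::field) \<Rightarrow> bool" where
  "rows_indep k m M \<longleftrightarrow>
     (\<forall>c. (\<forall>j<m. (\<Sum>i<k. c i * M i j) = 0) \<longrightarrow> (\<forall>i<k. c i = 0))"

text \<open>Affine flag variety: M k is a k x n matrix whose row span L_k has dimension k,
  the L_k are nested, and q_S = c_k * Plucker coordinate of L_k for |S| = k.\<close>
definition Fl :: "nat \<Rightarrow> (nat set \<Rightarrow> 'a::field) set" where
  "Fl n = {q. \<exists>(M :: nat \<Rightarrow> nat \<Rightarrow> nat \<Rightarrow> 'a) (c :: nat \<Rightarrow> 'a).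
       (\<forall>k\<le>n. c k \<noteq> 0 \<and> rows_indep k n (M k)) \<and>
       (\<forall>k<n. row_span k n (M k) \<subseteq> row_span (Suc k) n (M (Suc k))) \<and>
       q = (\<lambda>S. if S \<subseteq> {0..<n} then c (card S) * minor (card S) (M (card S)) S else 0)}"

definition nu :: "nat set set \<Rightarrow> ('a::field \<Rightarrow> real) \<Rightarrow> (nat set \<Rightarrow> 'a) set \<Rightarrow> (nat set \<Rightarrow> real) set" where
  "nu I val X = {(\<lambda>C. if C \<in> I then - val (x C) else 0) | x. x \<in> X \<and> (\<forall>C\<in>I. x C \<noteq> 0)}"

text \<open>Euclidean closure; all points vanish outside the finite index set, so the product
  topology on nat set \<Rightarrow> real restricted to them is the Euclidean one.\<close>
definition trop :: "nat set set \<Rightarrow> ('a::field \<Rightarrow> real) \<Rightarrow> (nat set \<Rightarrow> 'a) set \<Rightarrow> (nat set \<Rightarrow> real) set" where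
  "trop I val X = closure (nu I val X)"

definition SUBMOD :: "nat \<Rightarrow> (nat set \<Rightarrow> real) set" where
  "SUBMOD n = {F. \<forall>S T. S \<subseteq> {0..<n} \<longrightarrow> T \<subseteq> {0..<n} \<longrightarrow>
                  F (S \<inter> T) + F (S \<union> T) \<le> F S + F T}"

definition Lspace :: "nat \<Rightarrow> (nat set \<Rightarrow> real) set" where
  "Lspace n = {p. \<forall>C\<in>Gr_idx n. \<forall>D\<in>Gr_idx n.
                   C \<inter> {0..<n} = D \<inter> {0..<n} \<longrightarrow> p C = p D}"

definition phi :: "nat \<Rightarrow> (nat set \<Rightarrow> real) \<Rightarrow> (nat set \<Rightarrow> real)" where
  "phi n p = (\<lambda>S. if S \<subseteq> {0..<n} then p (S \<union> {n..<n + (n - card S)}) else 0)"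

end

theory Submission
  imports Defs "Jordan_Normal_Form.Determinant" "HOL-Library.Nat_Bijection"
begin

text \<open>Write \<open>\<nu> = - val\<close> and \<open>F S = \<nu> (q S)\<close>.

  From \<open>Gr\<close> to \<open>Fl\<close>: a row space \<open>L\<close> with nonzero Pluecker coordinates gives the flag of the
  subspaces of \<open>L\<close> vanishing on \<open>{n..<2*n-k}\<close>, projected to the first \<open>n\<close> coordinates; submodularity
  on \<open>Lspace\<close> is the three-term Pluecker relation for two columns in each half.

  From \<open>Fl\<close> to \<open>Gr\<close>: choose \<open>a\<^sub>0, \<dots>, a\<^sub>n\<^sub>-\<^sub>1\<close> adapted to the flag with \<open>a\<^sub>i\<close> vanishing on \<open>{0..<i}\<close>. For every
  \<open>R\<close> with \<open>card R = i\<close> there is a unique vector \<open>a\<^sub>i + \<Sum>\<^sub>j\<^sub><\<^sub>i c\<^sub>j a\<^sub>j\<close> vanishing on \<open>R\<close>, and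
  submodularity says exactly that exchanging one element of \<open>R\<close> changes the \<open>c\<^sub>j\<close> by integral
  amounts; hence all \<open>c\<^sub>j\<close> are integral. Now append to the matrix \<open>A\<close> of the \<open>a\<^sub>i\<close> a generic integral
  \<open>n\<close> by \<open>n\<close> matrix. The minor at \<open>S \<union> T\<close> is an integral multiple of \<open>q S\<close>, because row operations turn
  the rows from \<open>card S\<close> on into vectors vanishing on \<open>S\<close>; and it is not smaller than \<open>q S\<close>, because \<open>q S\<close>
  is one of the coefficients of the generic minor.

  For the closures: the value group contains arbitrarily small positive \<open>\<epsilon>\<close>, and subtracting
  \<open>\<epsilon> (card S)\<^sup>2\<close> turns approximations of a submodular function into submodular ones.\<close>

subsection \<open>Minors as determinants of column lists\<close>

text \<open>Columns come as a list in arbitrary order, so that block decompositions are plain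
  appends; \<open>minor\<close> is the case of a sorted list.\<close>

definition col_det :: "nat \<Rightarrow> (nat \<Rightarrow> nat \<Rightarrow> 'a::field) \<Rightarrow> nat list \<Rightarrow> 'a" where
  "col_det k M cs = Determinant.det (Matrix.mat k k (\<lambda>(i,j). M i (cs ! j)))"

lemma minor_eq_col_det: "minor k M S = col_det k M (sorted_list_of_set S)"
  unfolding minor_def col_det_def
  by (subst det_def'[of _ k])
    (auto simp: atLeast0LessThan intro!: sum.cong prod.cong dest: permutes_in_image)

lemma col_det_cong:
  assumes "\<And>i c. i < k \<Longrightarrow> c \<in> set cs \<Longrightarrow> M i c = N i c" "length cs = k"
  shows "col_det k M cs = col_det k N cs"
  unfolding col_det_def using assms by (intro arg_cong[of _ _ Determinant.det] eq_matI) auto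

lemma col_det_permute:
  assumes "distinct cs" "length cs = k" "p permutes {..<k}"
  shows "col_det k M (permute_list p cs) = of_int (sign p) * col_det k M cs"
proof -
  let ?A = "Matrix.mat k k (\<lambda>(i,j). M i (cs ! j))"
  let ?B = "Matrix.mat k k (\<lambda>(i,j). M i (permute_list p cs ! j))"
  have p: "p permutes {0..<k}" using assms by (simp add: atLeast0LessThan)
  have pk: "p j < k" if "j < k" for j
    using permutes_in_image[OF p, of j] that by auto
  have "Determinant.det ?B = Determinant.det (transpose_mat ?B)"
    by (simp add: det_transpose[of _ k])
  also have "transpose_mat ?B = Matrix.mat k k (\<lambda>(i,j). transpose_mat ?A $$ (p i, j))"
    by (rule eq_matI) (use assms pk in \<open>auto simp: permute_list_nth\<close>)
  also have "Determinant.det \<dots> = of_int (sign p) * Determinant.det (transpose_mat ?A)"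
    by (rule det_permute_rows[OF _ p]) simp
  also have "Determinant.det (transpose_mat ?A) = Determinant.det ?A"
    by (simp add: det_transpose[of _ k])
  finally show ?thesis by (simp add: col_det_def)
qed

text \<open>Sorting \<open>cs\<close> is a permutation of columns. Its sign is left open because
  \<open>val\<close> cannot see it.\<close>

lemma col_det_eq_minor_or_neg:
  assumes "distinct cs" "length cs = k"
  shows "col_det k M cs = minor k M (set cs) \<or> col_det k M cs = - minor k M (set cs)"
proof -
  let ?ss = "sorted_list_of_set (set cs)"
  have "mset ?ss = mset cs"
    using assms by (simp add: set_eq_iff_mset_eq_distinct[symmetric])
  then obtain p where p: "p permutes {..<length cs}" "permute_list p cs = ?ss"
    by (rule mset_eq_permutation)
  have "minor k M (set cs) = of_int (sign p) * col_det k M cs"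
    unfolding minor_eq_col_det p(2)[symmetric]
    by (rule col_det_permute) (use assms p in auto)
  then show ?thesis by (cases p rule: sign_cases) auto
qed

text \<open>Multiplicativity of the determinant, read as row operations: \<open>U\<close> scales
  every maximal minor by the same factor, whatever the columns.\<close>

lemma col_det_mult:
  assumes "length cs = k"
  shows "col_det k (\<lambda>i c. \<Sum>l<k. U i l * M l c) cs
    = Determinant.det (Matrix.mat k k (\<lambda>(i,j). U i j)) * col_det k M cs"
proof -
  have "Matrix.mat k k (\<lambda>(i,j). \<Sum>l<k. U i l * M l (cs ! j))
    = Matrix.mat k k (\<lambda>(i,j). U i j) * Matrix.mat k k (\<lambda>(i,j). M i (cs ! j))"
    by (rule eq_matI) (auto simp: scalar_prod_def atLeast0LessThan)
  then show ?thesis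
    unfolding col_det_def by (simp add: det_mult[of _ k])
qed

lemma col_det_block_lower_zero:
  assumes "length cs = a" "length ds = b"
    and "\<And>i c. a \<le> i \<Longrightarrow> i < a + b \<Longrightarrow> c \<in> set cs \<Longrightarrow> M i c = 0"
  shows "col_det (a + b) M (cs @ ds) = col_det a M cs * col_det b (\<lambda>i. M (a + i)) ds"
proof -
  have "Matrix.mat (a+b) (a+b) (\<lambda>(i,j). M i ((cs @ ds) ! j)) =
     four_block_mat (Matrix.mat a a (\<lambda>(i,j). M i (cs ! j))) (Matrix.mat a b (\<lambda>(i,j). M i (ds ! j)))
       (0\<^sub>m b a) (Matrix.mat b b (\<lambda>(i,j). M (a + i) (ds ! j)))"
    by (rule eq_matI) (use assms in \<open>auto simp: nth_append\<close>)
  then show ?thesis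
    unfolding col_det_def by (subst det_four_block_mat_lower_left_zero[symmetric]) auto
qed

lemma col_det_block_upper_zero:
  assumes "length cs = a" "length ds = b"
    and "\<And>i c. i < a \<Longrightarrow> c \<in> set ds \<Longrightarrow> M i c = 0"
  shows "col_det (a + b) M (cs @ ds) = col_det a M cs * col_det b (\<lambda>i. M (a + i)) ds"
proof -
  have "Matrix.mat (a+b) (a+b) (\<lambda>(i,j). M i ((cs @ ds) ! j)) =
     four_block_mat (Matrix.mat a a (\<lambda>(i,j). M i (cs ! j))) (0\<^sub>m a b)
       (Matrix.mat b a (\<lambda>(i,j). M (a + i) (cs ! j))) (Matrix.mat b b (\<lambda>(i,j). M (a + i) (ds ! j)))"
    by (rule eq_matI) (use assms in \<open>auto simp: nth_append\<close>)
  then show ?thesis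
    unfolding col_det_def by (subst det_four_block_mat_upper_right_zero[symmetric]) auto
qed

lemma col_det_1: "col_det (Suc 0) M [c] = M 0 c"
  unfolding col_det_def by (subst det_single) auto

lemma col_det_2: "col_det (Suc (Suc 0)) M [c, d] = M 0 c * M 1 d - M 0 d * M 1 c"
  unfolding col_det_def
  by (subst laplace_expansion_column[of _ 2 1])
    (auto simp: numeral_2_eq_2 cofactor_def mat_delete_def det_single[unfolded One_nat_def] algebra_simps)

lemma col_det_0: "col_det 0 M cs = 1"
  unfolding col_det_def by simp

lemma det_unitriangular:
  assumes "\<And>i. i < k \<Longrightarrow> U i i = 1" "\<And>i j. i < j \<Longrightarrow> j < k \<Longrightarrow> U i j = 0"
  shows "Determinant.det (Matrix.mat k k (\<lambda>(i,j). U i j)) = (1::'a::field)"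
proof -
  have "Determinant.det (Matrix.mat k k (\<lambda>(i,j). U i j)) = prod_list (diag_mat (Matrix.mat k k (\<lambda>(i,j). U i j)))"
    by (rule det_lower_triangular[of k]) (use assms in auto)
  also have "diag_mat (Matrix.mat k k (\<lambda>(i,j). U i j)) = map (\<lambda>_. 1) [0..<k]"
    unfolding diag_mat_def using assms by auto
  finally show ?thesis by (simp add: map_replicate_const prod_list_replicate)
qed

lemma col_det_inverse:
  assumes "col_det k M cs \<noteq> 0" 
  obtains B where "\<And>i j. i < k \<Longrightarrow> j < k \<Longrightarrow> (\<Sum>l<k. B i l * M l (cs ! j)) = (if i = j then 1 else 0)"
    "\<And>i j. i < k \<Longrightarrow> j < k \<Longrightarrow> (\<Sum>l<k. M i (cs ! l) * B l j) = (if i = j then 1 else 0)"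
proof -
  let ?A = "Matrix.mat k k (\<lambda>(i,j). M i (cs ! j))"
  have "?A \<in> Units (ring_mat TYPE('a) k ())"
    by (rule det_non_zero_imp_unit) (use assms in \<open>auto simp: col_det_def\<close>)
  then obtain B where B: "B \<in> carrier_mat k k" "B * ?A = 1\<^sub>m k" "?A * B = 1\<^sub>m k"
    unfolding Units_def by (auto simp: ring_mat_simps)
  have "(\<Sum>l<k. B $$ (i,l) * M l (cs ! j)) = (if i = j then 1 else 0)" if "i < k" "j < k" for i j
    using arg_cong[OF B(2), of "\<lambda>X. X $$ (i,j)"] that B(1)
    by (auto simp: scalar_prod_def atLeast0LessThan)
  moreover have "(\<Sum>l<k. M i (cs ! l) * B $$ (l,j)) = (if i = j then 1 else 0)" if "i < k" "j < k" for i j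
    using arg_cong[OF B(3), of "\<lambda>X. X $$ (i,j)"] that B(1)
    by (auto simp: scalar_prod_def atLeast0LessThan)
  ultimately show thesis by (rule that)
qed

text \<open>The columns in \<open>S\<close> form an invertible matrix, and \<open>w\<close> times
  its inverse gives \<open>c\<close>. This builds vectors of a flag member with prescribed
  entries.\<close>

lemma minor_solve:
  assumes "minor k M S \<noteq> 0" "finite S" "card S = k"
  obtains c where "\<And>s. s \<in> S \<Longrightarrow> (\<Sum>l<k. c l * M l s) = w s"
proof -
  let ?ss = "sorted_list_of_set S"
  obtain B where B: "\<And>i j. i < k \<Longrightarrow> j < k \<Longrightarrow> (\<Sum>l<k. B i l * M l (?ss ! j)) = (if i = j then 1 else 0)"
    using assms(1) unfolding minor_eq_col_det by (rule col_det_inverse) blast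
  have "(\<Sum>l<k. (\<Sum>i<k. w (?ss ! i) * B i l) * M l s) = w s" if "s \<in> S" for s
  proof -
    from that assms obtain j where j: "j < k" "?ss ! j = s"
      by (metis in_set_conv_nth set_sorted_list_of_set sorted_list_of_set.length_sorted_key_list_of_set)
    have "(\<Sum>l<k. (\<Sum>i<k. w (?ss ! i) * B i l) * M l s)
      = (\<Sum>l<k. \<Sum>i<k. w (?ss ! i) * (B i l * M l s))"
      by (simp add: sum_distrib_right mult.assoc)
    also have "\<dots> = (\<Sum>i<k. w (?ss ! i) * (\<Sum>l<k. B i l * M l s))"
      by (subst sum.swap) (simp add: sum_distrib_left)
    also have "\<dots> = (\<Sum>i<k. if i = j then w (?ss ! i) else 0)"
      using B j by (intro sum.cong) auto
    finally show ?thesis using j by simp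
  qed
  then show thesis by (rule that)
qed

lemma minor_kernel_trivial:
  assumes "minor k M S \<noteq> 0" "finite S" "card S = k"
    and "\<And>s. s \<in> S \<Longrightarrow> (\<Sum>l<k. c l * M l s) = 0" "i < k"
  shows "c i = 0"
proof -
  let ?ss = "sorted_list_of_set S"
  obtain B where B: "\<And>i j. i < k \<Longrightarrow> j < k \<Longrightarrow> (\<Sum>l<k. M i (?ss ! l) * B l j) = (if i = j then 1 else 0)"
    using assms(1) unfolding minor_eq_col_det by (rule col_det_inverse) blast
  have *: "(\<Sum>l<k. c l * M l (?ss ! j)) = 0" if "j < k" for j
    by (rule assms(4)) (use assms(2,3) that in \<open>metis nth_mem set_sorted_list_of_set sorted_list_of_set.length_sorted_key_list_of_set\<close>)
  have "c i = (\<Sum>l<k. if l = i then c l else 0)" using assms(5) by simp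
  also have "\<dots> = (\<Sum>l<k. c l * (\<Sum>j<k. M l (?ss ! j) * B j i))"
    by (rule sum.cong) (use assms(5) B in auto)
  also have "\<dots> = (\<Sum>l<k. \<Sum>j<k. c l * M l (?ss ! j) * B j i)"
    by (simp add: sum_distrib_left mult.assoc)
  also have "\<dots> = (\<Sum>j<k. (\<Sum>l<k. c l * M l (?ss ! j)) * B j i)"
    by (subst sum.swap) (simp add: sum_distrib_right)
  also have "\<dots> = 0" using * by simp
  finally show ?thesis .
qed

subsection \<open>Valuations and generic points\<close>

lemma prod_monom:
  "(\<Prod>i\<in>I. monom (a i) (b i)) = monom (\<Prod>i\<in>I. a i :: 'a :: comm_semiring_1) (\<Sum>i\<in>I. b i)"
  by (induction I rule: infinite_finite_induct) (auto simp: mult_monom monom_0 simp flip: one_pCons)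

lemma sorted_list_of_set_Un_append:
  assumes "finite S" "finite T" "\<And>x y. x \<in> S \<Longrightarrow> y \<in> T \<Longrightarrow> x < (y::'a::linorder)"
  shows "sorted_list_of_set (S \<union> T) = sorted_list_of_set S @ sorted_list_of_set T"
proof (rule sorted_distinct_set_unique)
  show "sorted (sorted_list_of_set S @ sorted_list_of_set T)"
    using assms by (auto simp: sorted_append intro: less_imp_le)
  have "S \<inter> T = {}" using assms(3) by force
  then show "distinct (sorted_list_of_set S @ sorted_list_of_set T)"
    using assms(1,2) by simp
qed (use assms(1,2) in auto)

section \<open>The valuation ring, its maximal ideal and polynomials over it\<close>

locale valued_field =
  fixes val :: "'a::field \<Rightarrow> real"
  assumes valuation: "valuation val"
begin

lemma val_mult: "x \<noteq> 0 \<Longrightarrow> y \<noteq> 0 \<Longrightarrow> val (x * y) = val x + val y"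
  and val_add: "x \<noteq> 0 \<Longrightarrow> y \<noteq> 0 \<Longrightarrow> x + y \<noteq> 0 \<Longrightarrow> min (val x) (val y) \<le> val (x + y)"
  and val_nontrivial: "\<exists>x. x \<noteq> 0 \<and> val x \<noteq> 0"
  using valuation unfolding valuation_def by blast+

lemma val_1 [simp]: "val 1 = 0"
  using val_mult[of 1 1] by simp

lemma val_minus [simp]: "val (- x) = val x"
proof (cases "x = 0")
  case False
  have "val (-1) = 0" using val_mult[of "-1" "-1"] by simp
  then show ?thesis using val_mult[of "-1" x] False by simp
qed simp

lemma val_divide: "x \<noteq> 0 \<Longrightarrow> y \<noteq> 0 \<Longrightarrow> val (x / y) = val x - val y"
  using val_mult[of "x / y" y] by simp

lemma zero_in_val_ring [simp]: "0 \<in> val_ring val"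
  and one_in_val_ring [simp]: "1 \<in> val_ring val"
  and zero_in_val_ideal [simp]: "0 \<in> val_ideal val"
  and one_notin_val_ideal [simp]: "1 \<notin> val_ideal val"
  by (auto simp: val_ring_def val_ideal_def)

lemma val_ring_uminus: "x \<in> val_ring val \<Longrightarrow> - x \<in> val_ring val"
  and val_ideal_uminus: "x \<in> val_ideal val \<Longrightarrow> - x \<in> val_ideal val"
  by (auto simp: val_ring_def val_ideal_def)

lemma val_ring_add: "x \<in> val_ring val \<Longrightarrow> y \<in> val_ring val \<Longrightarrow> x + y \<in> val_ring val"
proof (cases "x = 0 \<or> y = 0 \<or> x + y = 0")
  case False
  assume "x \<in> val_ring val" "y \<in> val_ring val"
  with False have "0 \<le> min (val x) (val y)" by (simp add: val_ring_def)
  with val_add[of x y] False have "0 \<le> val (x + y)"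
    by (auto simp: min_def split: if_splits)
  then show ?thesis by (simp add: val_ring_def)
qed (auto simp: val_ring_def)

lemma val_ideal_add: "x \<in> val_ideal val \<Longrightarrow> y \<in> val_ideal val \<Longrightarrow> x + y \<in> val_ideal val"
proof (cases "x = 0 \<or> y = 0 \<or> x + y = 0")
  case False
  assume "x \<in> val_ideal val" "y \<in> val_ideal val"
  with False have "0 < min (val x) (val y)" by (simp add: val_ideal_def)
  with val_add[of x y] False have "0 < val (x + y)"
    by (auto simp: min_def split: if_splits)
  then show ?thesis by (simp add: val_ideal_def)
qed (auto simp: val_ideal_def)

lemma val_ring_diff: "x \<in> val_ring val \<Longrightarrow> y \<in> val_ring val \<Longrightarrow> x - y \<in> val_ring val"
  using val_ring_add[of x "- y"] val_ring_uminus[of y] by simp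

lemma val_ideal_diff: "x \<in> val_ideal val \<Longrightarrow> y \<in> val_ideal val \<Longrightarrow> x - y \<in> val_ideal val"
  using val_ideal_add[of x "- y"] val_ideal_uminus[of y] by simp

lemma val_ring_mult: "x \<in> val_ring val \<Longrightarrow> y \<in> val_ring val \<Longrightarrow> x * y \<in> val_ring val"
  by (cases "x = 0 \<or> y = 0") (auto simp: val_ring_def val_mult)

lemma val_ideal_mult: "x \<in> val_ring val \<Longrightarrow> y \<in> val_ideal val \<Longrightarrow> x * y \<in> val_ideal val"
  by (cases "x = 0 \<or> y = 0") (auto simp: val_ring_def val_ideal_def val_mult)

lemma val_ideal_prime:
  "x \<in> val_ring val \<Longrightarrow> x \<notin> val_ideal val \<Longrightarrow> x * y \<in> val_ideal val \<Longrightarrow> y \<in> val_ideal val"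
  by (cases "x = 0 \<or> y = 0") (auto simp: val_ring_def val_ideal_def val_mult)

lemma val_ring_power: "x \<in> val_ring val \<Longrightarrow> x ^ k \<in> val_ring val"
  by (induction k) (auto intro: val_ring_mult)

lemma val_ring_sum: "(\<And>i. i \<in> I \<Longrightarrow> f i \<in> val_ring val) \<Longrightarrow> sum f I \<in> val_ring val"
  by (induction I rule: infinite_finite_induct) (auto intro: val_ring_add)

lemma val_ring_prod: "(\<And>i. i \<in> I \<Longrightarrow> f i \<in> val_ring val) \<Longrightarrow> prod f I \<in> val_ring val"
  by (induction I rule: infinite_finite_induct) (auto intro: val_ring_mult)

lemma val_ring_sign: "of_int (sign p) \<in> val_ring val"
  by (cases p rule: sign_cases) (auto intro: val_ring_uminus)

lemma val_ring_poly: "(\<And>i. coeff p i \<in> val_ring val) \<Longrightarrow> t \<in> val_ring val \<Longrightarrow> poly p t \<in> val_ring val"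
  unfolding poly_altdef by (auto intro!: val_ring_sum val_ring_mult val_ring_power)

lemma val_ring_col_det:
  assumes "\<And>i c. i < k \<Longrightarrow> c \<in> set cs \<Longrightarrow> M i c \<in> val_ring val" "length cs = k"
  shows "col_det k M cs \<in> val_ring val"
  unfolding col_det_def
  by (subst det_def'[of _ k])
    (use assms in \<open>auto intro!: val_ring_sum val_ring_mult val_ring_sign val_ring_prod
      simp: permutes_in_image\<close>)

lemma val_col_det:
  assumes "distinct cs" "length cs = k"
  shows "val (col_det k M cs) = val (minor k M (set cs))"
  using col_det_eq_minor_or_neg[OF assms, of M] by auto

text \<open>Horner's recurrence expresses coefficient \<open>i\<close> of the quotient by
  coefficient \<open>Suc i\<close>; hence a downward induction from beyond the degree.\<close>

lemma coeff_synthetic_div_in_val_ring: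
  assumes p: "\<And>i. coeff p i \<in> val_ring val" and t: "t \<in> val_ring val"
  shows "coeff (synthetic_div p t) i \<in> val_ring val"
proof (induction "Suc (degree (synthetic_div p t)) - i" arbitrary: i)
  case 0
  then show ?case by (simp add: coeff_eq_0)
next
  case (Suc m)
  let ?q = "synthetic_div p t"
  have "coeff p (Suc i) = coeff (p + Polynomial.smult t ?q) (Suc i) - t * coeff ?q (Suc i)" by simp
  also have "p + Polynomial.smult t ?q = pCons (poly p t) ?q" by (rule synthetic_div_correct)
  finally have "coeff ?q i = coeff p (Suc i) + t * coeff ?q (Suc i)" by simp
  also have "\<dots> \<in> val_ring val"
    using Suc p t by (auto intro!: val_ring_add val_ring_mult)
  finally show ?case .
qed

text \<open>A polynomial over the residue field with more roots than its degree is zero; working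
  with lifts avoids building that field as a type. The induction splits off one root at a
  time.\<close>

lemma coeff_in_val_ideal_if_many_roots:
  assumes "\<And>i. coeff p i \<in> val_ring val" "finite T" "T \<subseteq> val_ring val" "degree p < card T"
    and "\<And>x y. x \<in> T \<Longrightarrow> y \<in> T \<Longrightarrow> x \<noteq> y \<Longrightarrow> x - y \<notin> val_ideal val"
    and "\<And>t. t \<in> T \<Longrightarrow> poly p t \<in> val_ideal val"
  shows "coeff p i \<in> val_ideal val"
  using assms
proof (induction "degree p" arbitrary: p T i)
  case 0
  then have "T \<noteq> {}" by auto
  then obtain t where "t \<in> T" by blast
  with 0(7) have "poly p t \<in> val_ideal val" by blast
  moreover from 0(1) obtain a where "p = [:a:]"
    by (cases p) (auto split: if_splits)
  ultimately have "coeff p 0 \<in> val_ideal val" by simp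
  moreover have "coeff p i = 0" if "i \<noteq> 0"
    using that 0(1) by (simp add: coeff_eq_0)
  ultimately show ?case by (cases "i = 0") auto
next
  case (Suc d)
  from Suc.prems(4) have "T \<noteq> {}" by auto
  then obtain t where t: "t \<in> T" by blast
  let ?q = "synthetic_div p t"
  have p_eq: "[:- t, 1:] * ?q + [:poly p t:] = p"
    using synthetic_div_correct'[of t p] .
  have q: "coeff ?q j \<in> val_ideal val" for j
  proof (rule Suc.hyps(1)[of ?q "T - {t}"])
    show "d = degree ?q" using Suc.hyps(2) by (simp add: degree_synthetic_div)
    show "finite (T - {t})" "T - {t} \<subseteq> val_ring val" using Suc.prems(2,3) by auto
    show "x - y \<notin> val_ideal val" if "x \<in> T - {t}" "y \<in> T - {t}" "x \<noteq> y" for x y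
      using that Suc.prems(5) by blast
    show "degree ?q < card (T - {t})"
      using Suc.hyps(2) Suc.prems(2,4) t by (simp add: degree_synthetic_div)
    show "coeff ?q i \<in> val_ring val" for i
      using coeff_synthetic_div_in_val_ring[of p t] Suc.prems(1,3) t by blast
    fix s assume s: "s \<in> T - {t}"
    \<comment> \<open>\<open>s - t\<close> is a unit of the valuation ring, so the other points of
      \<open>T\<close> are roots of the quotient modulo the ideal.\<close>
    have "(s - t) * poly ?q s = poly p s - poly p t"
      by (subst (2) p_eq[symmetric]) (simp add: algebra_simps)
    also have "\<dots> \<in> val_ideal val" using Suc.prems(6) s t by (auto intro: val_ideal_diff)
    finally show "poly ?q s \<in> val_ideal val"
      using s t Suc.prems(3) Suc.prems(5)[of s t]
      by (intro val_ideal_prime[of "s - t" "poly ?q s"]) (auto intro: val_ring_diff)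
  qed
  have "coeff p i = (case i of 0 \<Rightarrow> poly p t | Suc j \<Rightarrow> coeff ?q j) - t * coeff ?q i"
    by (subst (1) p_eq[symmetric]) (cases i; simp)
  also have "\<dots> \<in> val_ideal val"
    using q t Suc.prems(3) Suc.prems(6)[OF t]
    by (intro val_ideal_diff val_ideal_mult) (auto split: nat.split)
  finally show ?case .
qed

definition residue_class :: "'a \<Rightarrow> 'a set" where
  "residue_class x = {y \<in> val_ring val. x - y \<in> val_ideal val}"

lemma residue_class_eqI:
  assumes "x - y \<in> val_ideal val"
  shows "residue_class x = residue_class y"
proof -
  have "x - z \<in> val_ideal val \<longleftrightarrow> y - z \<in> val_ideal val" for z
  proof
    assume "x - z \<in> val_ideal val"
    from val_ideal_diff[OF this assms] show "y - z \<in> val_ideal val" by simp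
  next
    assume "y - z \<in> val_ideal val"
    from val_ideal_add[OF assms this] show "x - z \<in> val_ideal val" by simp
  qed
  then show ?thesis by (simp add: residue_class_def)
qed

text \<open>Divided by a coefficient of minimal valuation, \<open>p\<close> becomes integral with
  one coefficient equal to 1, hence nonzero modulo the ideal. Every exceptional \<open>t\<close> is
  a root of it modulo the ideal, and such roots fill only finitely many residue classes.\<close>

lemma finite_residues_poly_val_gt:
  assumes "p \<noteq> 0"
  shows "finite (residue_class ` {t \<in> val_ring val.
    \<not> (poly p t \<noteq> 0 \<and> (\<forall>i. coeff p i \<noteq> 0 \<longrightarrow> val (poly p t) \<le> val (coeff p i)))})"
    (is "finite (residue_class ` ?B)")
proof -
  let ?I = "{i. coeff p i \<noteq> 0}"
  have "finite ?I" by (rule finite_subset[of _ "{..degree p}"]) (auto intro: le_degree)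
  moreover have "?I \<noteq> {}" using assms by (auto simp: poly_eq_iff)
  ultimately obtain m where m: "coeff p m \<noteq> 0"
      "\<And>i. coeff p i \<noteq> 0 \<Longrightarrow> val (coeff p m) \<le> val (coeff p i)"
    using ex_is_arg_min_if_finite[of ?I "\<lambda>i. val (coeff p i)"]
    unfolding is_arg_min_linorder by blast
  define r where "r = Polynomial.smult (1 / coeff p m) p"
  have r: "coeff r i \<in> val_ring val" for i
    using m(1) m(2)[of i] by (cases "coeff p i = 0") (auto simp: r_def val_ring_def val_divide)
  have sub: "?B \<subseteq> {t \<in> val_ring val. poly r t \<in> val_ideal val}" (is "_ \<subseteq> ?C")
  proof (rule ccontr)
    assume "\<not> ?thesis"
    then obtain t where t: "t \<in> val_ring val" "t \<in> ?B" "poly r t \<notin> val_ideal val" by blast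
    have "poly r t \<in> val_ring val" using val_ring_poly r t(1) by blast
    with t(3) have rt: "poly r t \<noteq> 0" "val (poly r t) = 0"
      by (auto simp: val_ring_def val_ideal_def)
    have eq: "poly r t = poly p t / coeff p m" by (simp add: r_def)
    have "poly p t \<noteq> 0" using rt(1) eq by auto
    moreover from this have "val (poly p t) = val (coeff p m)"
      using rt(2) m(1) by (simp add: eq val_divide)
    ultimately have "poly p t \<noteq> 0 \<and> (\<forall>i. coeff p i \<noteq> 0 \<longrightarrow> val (poly p t) \<le> val (coeff p i))"
      using m(2) by metis
    with t(2) show False by blast
  qed
  have "finite (residue_class ` ?C)"
  proof (rule ccontr)
    assume "infinite (residue_class ` ?C)"
    then obtain D where D: "D \<subseteq> residue_class ` ?C" "finite D" "card D = Suc (degree r)"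
      using infinite_arbitrarily_large[of _ "Suc (degree r)"] by blast
    then obtain T where T: "T \<subseteq> ?C" "inj_on residue_class T" "D = residue_class ` T"
      using subset_image_inj[of D residue_class ?C] by blast
    have "coeff r m \<in> val_ideal val"
    proof (rule coeff_in_val_ideal_if_many_roots[of r T])
      show "finite T" using D(2) T(2,3) by (simp add: finite_image_iff)
      show "degree r < card T" using D T by (simp add: card_image)
      show "x - y \<notin> val_ideal val" if "x \<in> T" "y \<in> T" "x \<noteq> y" for x y
        using that T(2) residue_class_eqI[of x y] by (meson inj_onD)
      show "coeff r i \<in> val_ring val" for i by (rule r)
      show "T \<subseteq> val_ring val" using T(1) by auto
      show "poly r t \<in> val_ideal val" if "t \<in> T" for t
        using T(1) that by auto
    qed
    then show False using m by (simp add: r_def)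
  qed
  then show ?thesis using sub by (meson finite_subset image_mono)
qed

text \<open>Each polynomial excludes finitely many residue classes, so an infinite residue field
  leaves a \<open>t\<close> that is good for all of \<open>P\<close> at once.\<close>

lemma ex_generic_point:
  assumes "infinite (residue_field val)" "finite P" "0 \<notin> P"
  obtains t where "t \<in> val_ring val"
    "\<And>p. p \<in> P \<Longrightarrow> poly p t \<noteq> 0"
    "\<And>p i. p \<in> P \<Longrightarrow> coeff p i \<noteq> 0 \<Longrightarrow> val (poly p t) \<le> val (coeff p i)"
proof -
  let ?B = "\<lambda>p. {t \<in> val_ring val.
    \<not> (poly p t \<noteq> 0 \<and> (\<forall>i. coeff p i \<noteq> 0 \<longrightarrow> val (poly p t) \<le> val (coeff p i)))}"
  have "finite (\<Union>p\<in>P. residue_class ` ?B p)"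
  proof (rule finite_UN_I[OF assms(2)])
    fix p assume "p \<in> P"
    with assms(3) have "p \<noteq> 0" by blast
    then show "finite (residue_class ` ?B p)" by (rule finite_residues_poly_val_gt)
  qed
  moreover have "residue_field val = residue_class ` val_ring val"
    by (simp add: residue_field_def residue_class_def)
  ultimately have "\<not> residue_class ` val_ring val \<subseteq> (\<Union>p\<in>P. residue_class ` ?B p)"
    using assms(1) by (auto dest: finite_subset)
  then obtain t where "t \<in> val_ring val" "\<And>p. p \<in> P \<Longrightarrow> t \<notin> ?B p" by blast
  then show thesis by (intro that[of t]) blast+
qed

end

subsection \<open>Integral bases adapted to a submodular flag\<close>

text \<open>The first \<open>k\<close> rows of \<open>A\<close> span the
  \<open>k\<close>-dimensional flag member. The last assumption is local submodularity of the
  negated valuations of the minors; triangularity starts the induction for integrality.\<close>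

locale submodular_flag = valued_field val for val :: "'a::field \<Rightarrow> real" +
  fixes n :: nat and A :: "nat \<Rightarrow> nat \<Rightarrow> 'a"
  assumes minor_nonzero: "\<And>S. S \<subseteq> {0..<n} \<Longrightarrow> minor (card S) A S \<noteq> 0"
    and upper_triangular: "\<And>i j. i < n \<Longrightarrow> j < i \<Longrightarrow> A i j = 0"
    and val_minor_submodular: "\<And>R x y. R \<subseteq> {0..<n} \<Longrightarrow> x \<in> {0..<n} - R \<Longrightarrow> y \<in> {0..<n} - R \<Longrightarrow> x \<noteq> y \<Longrightarrow>
      val (minor (Suc (card R)) A (insert x R)) + val (minor (Suc (card R)) A (insert y R))
      \<le> val (minor (card R) A R) + val (minor (Suc (Suc (card R))) A (insert x (insert y R)))"
begin

text \<open>The coefficients \<open>c\<close> of the vector of the \<open>Suc (card R)\<close>-dimensional flag member that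
  vanishes on \<open>R\<close>, normalised to have leading coefficient 1.\<close>
definition vanishing_coeffs :: "nat set \<Rightarrow> (nat \<Rightarrow> 'a) \<Rightarrow> bool" where
  "vanishing_coeffs R c \<longleftrightarrow> c (card R) = 1 \<and> (\<forall>s\<in>R. (\<Sum>l<Suc (card R). c l * A l s) = 0)"

lemma finite_sub: "R \<subseteq> {0..<n} \<Longrightarrow> finite R"
  by (rule finite_subset) auto

lemma ex_vanishing_coeffs:
  assumes "R \<subseteq> {0..<n}"
  obtains c where "vanishing_coeffs R c"
proof -
  obtain c where c: "\<And>s. s \<in> R \<Longrightarrow> (\<Sum>l<card R. c l * A l s) = - A (card R) s"
    by (rule minor_solve[OF minor_nonzero[OF assms] finite_sub[OF assms] refl,
        of "\<lambda>s. - A (card R) s"]) blast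
  have "vanishing_coeffs R (\<lambda>l. if l = card R then 1 else c l)"
    using c by (auto simp: vanishing_coeffs_def)
  then show thesis by (rule that)
qed

text \<open>Replacing row \<open>card R\<close> of \<open>A\<close> by the vanishing vector is a
  unitriangular row operation that makes the columns \<open>R\<close>, \<open>y\<close> block
  triangular: the minor on \<open>insert y R\<close> is, up to sign, the minor on \<open>R\<close>
  times the entry at \<open>y\<close>.\<close>

lemma vanishing_coeffs_value:
  assumes R: "R \<subseteq> {0..<n}" and y: "y \<in> {0..<n} - R" and c: "vanishing_coeffs R c"
  shows "(\<Sum>l<Suc (card R). c l * A l y) \<noteq> 0"
    and "val (\<Sum>l<Suc (card R). c l * A l y)
      = val (minor (Suc (card R)) A (insert y R)) - val (minor (card R) A R)"
proof -
  let ?k = "card R" and ?v = "\<Sum>l<Suc (card R). c l * A l y"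
  let ?ss = "sorted_list_of_set R"
  define U where "U i j = (if i < ?k then if i = j then 1 else 0 else if j \<le> ?k then c j else 0)" for i j
  define N where "N i s = (\<Sum>l<Suc ?k. U i l * A l s)" for i s
  have fin: "finite R" using R by (rule finite_sub)
  have N_upper: "N i s = A i s" if "i < ?k" for i s
    using that by (simp add: N_def U_def if_distrib[of "\<lambda>x. x * _"] cong: if_cong)
  have N_last: "N ?k s = (\<Sum>l<Suc ?k. c l * A l s)" for s
    unfolding N_def U_def by (rule sum.cong) auto
  have "col_det (Suc ?k) N (?ss @ [y])
    = Determinant.det (Matrix.mat (Suc ?k) (Suc ?k) (\<lambda>(i,j). U i j)) * col_det (Suc ?k) A (?ss @ [y])"
    unfolding N_def by (rule col_det_mult) simp
  also have "Determinant.det (Matrix.mat (Suc ?k) (Suc ?k) (\<lambda>(i,j). U i j)) = 1"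
    by (rule det_unitriangular) (use c in \<open>auto simp: U_def vanishing_coeffs_def less_Suc_eq\<close>)
  also have "col_det (Suc ?k) N (?ss @ [y]) = col_det ?k N ?ss * col_det (Suc 0) (\<lambda>i. N (?k + i)) [y]"
    using col_det_block_lower_zero[of ?ss ?k "[y]" "Suc 0" N] c fin N_last
    by (auto simp: vanishing_coeffs_def less_Suc_eq)
  also have "col_det ?k N ?ss = minor ?k A R"
    unfolding minor_eq_col_det by (rule col_det_cong) (use N_upper in auto)
  also have "col_det (Suc 0) (\<lambda>i. N (?k + i)) [y] = ?v"
    by (simp add: col_det_1 N_last del: sum.lessThan_Suc)
  finally have eq: "col_det (Suc ?k) A (?ss @ [y]) = minor ?k A R * ?v" by simp
  have val_eq: "val (col_det (Suc ?k) A (?ss @ [y])) = val (minor (Suc ?k) A (insert y R))"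
    using val_col_det[of "?ss @ [y]" "Suc ?k" A] y fin by simp
  have ins: "insert y R \<subseteq> {0..<n}" "card (insert y R) = Suc ?k"
    using R y fin by auto
  have "col_det (Suc ?k) A (?ss @ [y]) \<noteq> 0"
    using col_det_eq_minor_or_neg[of "?ss @ [y]" "Suc ?k" A] minor_nonzero[OF ins(1)] y fin
    unfolding ins(2) by auto
  then show v: "?v \<noteq> 0" unfolding eq by simp
  show "val ?v = val (minor (Suc ?k) A (insert y R)) - val (minor ?k A R)"
    using val_eq val_mult[OF minor_nonzero[OF R] v] unfolding eq by simp
qed

lemma vanishing_coeffs_unique:
  assumes R: "R \<subseteq> {0..<n}" and c: "vanishing_coeffs R c" "vanishing_coeffs R d" and "l \<le> card R"
  shows "c l = d l"
proof (cases "l = card R")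
  case True
  then show ?thesis using c by (simp add: vanishing_coeffs_def)
next
  case False
  have "c l - d l = 0"
  proof (rule minor_kernel_trivial[OF minor_nonzero[OF R] finite_sub[OF R] refl, of "\<lambda>l. c l - d l"])
    fix s assume s: "s \<in> R"
    have "(\<Sum>l<Suc (card R). c l * A l s) - (\<Sum>l<Suc (card R). d l * A l s) = 0"
      using c s by (simp add: vanishing_coeffs_def del: sum.lessThan_Suc)
    moreover have "c (card R) = 1" "d (card R) = 1"
      using c by (auto simp: vanishing_coeffs_def)
    ultimately show "(\<Sum>l<card R. (c l - d l) * A l s) = 0"
      by (simp add: left_diff_distrib sum_subtractf)
  qed (use False assms(4) in simp)
  then show ?thesis by simp
qed

text \<open>Exchanging \<open>x\<close> for \<open>y\<close> in the vanishing set changes the vector by a multiple of the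
  vector of one dimension less; local submodularity says that the factor is integral.\<close>
lemma vanishing_coeffs_exchange:
  assumes R: "R \<subseteq> {0..<n}" and x: "x \<in> {0..<n} - R" and y: "y \<in> {0..<n} - R" and xy: "x \<noteq> y"
    and c: "vanishing_coeffs (insert x R) c" and c': "vanishing_coeffs (insert y R) c'"
    and d: "vanishing_coeffs R d"
  obtains e where "e \<in> val_ring val" "\<And>l. l \<le> card R \<Longrightarrow> c l = c' l + e * d l"
proof
  let ?i = "card R"
  define e where "e = c ?i - c' ?i"
  have fin: "finite R" using R by (rule finite_sub)
  have card: "card (insert x R) = Suc ?i" "card (insert y R) = Suc ?i"
    using x y fin by auto
  note c = c[unfolded vanishing_coeffs_def card] and c' = c'[unfolded vanishing_coeffs_def card]
  have d1: "d ?i = 1" using d by (simp add: vanishing_coeffs_def)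
  \<comment> \<open>The leading coefficients 1 cancel in \<open>c - c'\<close>, whose next
    coefficient is \<open>e\<close>. Subtracting \<open>e * d\<close> leaves a combination of the
    first \<open>?i\<close> rows that vanishes on \<open>R\<close>.\<close>
  have low: "c l - c' l - e * d l = 0" if "l < ?i" for l
  proof (rule minor_kernel_trivial[OF minor_nonzero[OF R] fin refl _ that,
        of "\<lambda>l. c l - c' l - e * d l"])
    fix s assume s: "s \<in> R"
    have "(\<Sum>l<Suc (Suc ?i). c l * A l s) - (\<Sum>l<Suc (Suc ?i). c' l * A l s)
      - e * (\<Sum>l<Suc ?i. d l * A l s) = 0"
      using c c' d s by (simp add: vanishing_coeffs_def del: sum.lessThan_Suc)
    then show "(\<Sum>l<?i. (c l - c' l - e * d l) * A l s) = 0"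
      using c c' d1
      by (simp add: e_def algebra_simps sum_subtractf sum.distrib sum_distrib_left)
  qed
  then show eq: "c l = c' l + e * d l" if "l \<le> ?i" for l
    using that d1 by (cases "l = ?i") (auto simp: e_def algebra_simps dest!: low)
  \<comment> \<open>At \<open>y\<close> the vector of \<open>c'\<close> vanishes, so
    \<open>e\<close> is a quotient of two entries of known valuation.\<close>
  have "(\<Sum>l<Suc (Suc ?i). c l * A l y)
    = (\<Sum>l<Suc (Suc ?i). c' l * A l y) + e * (\<Sum>l<Suc ?i. d l * A l y)"
    using c c' eq by (simp add: algebra_simps sum.distrib sum_distrib_left)
  then have y_eq: "(\<Sum>l<Suc (Suc ?i). c l * A l y) = e * (\<Sum>l<Suc ?i. d l * A l y)"
    using c' by (metis add_0 insertI1)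
  have sub: "insert x R \<subseteq> {0..<n}" "y \<in> {0..<n} - insert x R" using R x y xy by auto
  note valc = vanishing_coeffs_value[OF sub assms(5), unfolded card]
  note vald = vanishing_coeffs_value[OF R y d]
  have "e \<noteq> 0" using valc(1) y_eq by auto
  then have "val e = val (minor (Suc (Suc ?i)) A (insert y (insert x R))) - val (minor (Suc ?i) A (insert x R))
     - (val (minor (Suc ?i) A (insert y R)) - val (minor ?i A R))"
    using valc(2) vald val_mult[of e "\<Sum>l<Suc ?i. d l * A l y"] unfolding y_eq by simp
  also have "\<dots> \<ge> 0"
    using val_minor_submodular[OF R x y xy] by (simp add: insert_commute)
  finally show "e \<in> val_ring val" by (simp add: val_ring_def)
qed

lemma vanishing_coeffs_initial:
  assumes "k < n"
  shows "vanishing_coeffs {0..<k} (\<lambda>l. if l = k then 1 else 0)"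
  using assms upper_triangular
  by (simp add: vanishing_coeffs_def if_distrib[of "\<lambda>x. x * _"] cong: if_cong)

text \<open>Lexicographic induction on \<open>card R\<close> and the number of elements of
  \<open>R\<close> outside \<open>{0..<card R}\<close>. If there are none, the vector is a row of
  \<open>A\<close>. Otherwise an outside \<open>x\<close> is exchanged for a missing
  \<open>y\<close> inside: \<open>insert y R0\<close> lowers the second measure, \<open>R0\<close>
  the first.\<close>

lemma vanishing_coeffs_integral:
  assumes "R \<subseteq> {0..<n}" "card R < n" "vanishing_coeffs R c" "l \<le> card R"
  shows "c l \<in> val_ring val"
  using assms
proof (induction R arbitrary: c l
    rule: wf_induct_rule[OF wf_measures[of "[card, \<lambda>R. card (R - {0..<card R})]"]])
  case less: (1 R)
  note R = \<open>R \<subseteq> {0..<n}\<close>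
  have fin: "finite R" using R by (rule finite_sub)
  show ?case
  proof (cases "R \<subseteq> {0..<card R}")
    case True
    then have "R = {0..<card R}" by (rule card_subset_eq[rotated]) auto
    then have "vanishing_coeffs R (\<lambda>l. if l = card R then 1 else 0)"
      by (subst (1) \<open>R = {0..<card R}\<close>) (rule vanishing_coeffs_initial[OF less.prems(2)])
    from vanishing_coeffs_unique[OF R less.prems(3) this less.prems(4)]
    show ?thesis by simp
  next
    case False
    then obtain x where x: "x \<in> R" "x \<notin> {0..<card R}" by blast
    have "\<not> {0..<card R} \<subseteq> R"
    proof
      assume "{0..<card R} \<subseteq> R"
      then have "{0..<card R} = R" by (rule card_subset_eq[OF fin]) simp
      then show False using x by blast
    qed
    then obtain y where y: "y < card R" "y \<notin> R"
      unfolding subset_iff atLeastLessThan_iff by blast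
    define R0 where "R0 = R - {x}"
    have R0: "R0 \<subseteq> {0..<n}" "x \<in> {0..<n} - R0" "y \<in> {0..<n} - R0" "x \<noteq> y" "R = insert x R0"
      using R x y(1,2) less.prems(2) unfolding R0_def by auto
    have fin0: "finite R0" using fin by (simp add: R0_def)
    have card: "card R = Suc (card R0)"
      using card.remove[OF fin x(1)] by (simp add: R0_def)
    have card': "card (insert y R0) = Suc (card R0)"
      using fin0 R0(3) by simp
    have "insert y R0 \<subseteq> {0..<n}" using R0(1,3) by blast
    then obtain c' where c': "vanishing_coeffs (insert y R0) c'"
      by (rule ex_vanishing_coeffs)
    obtain d where d: "vanishing_coeffs R0 d" using R0(1) by (rule ex_vanishing_coeffs)
    have "insert y R0 - {0..<card R} \<subseteq> R - {0..<card R}"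
      using y(1) unfolding R0_def by auto
    moreover have "x \<in> R - {0..<card R}" "x \<notin> insert y R0 - {0..<card R}"
      using x R0(4) unfolding R0_def by blast+
    ultimately have "insert y R0 - {0..<card R} \<subset> R - {0..<card R}" by blast
    then have smaller: "card (insert y R0 - {0..<card (insert y R0)}) < card (R - {0..<card R})"
      unfolding card' card[symmetric] by (rule psubset_card_mono[OF finite_Diff[OF fin]])
    have c'_int: "c' l \<in> val_ring val" if "l \<le> card R" for l
    proof (rule less.IH[OF _ _ _ c'])
      show "(insert y R0, R) \<in> measures [card, \<lambda>R. card (R - {0..<card R})]"
        using smaller card card' by simp
      show "insert y R0 \<subseteq> {0..<n}" using R0(1,3) by blast
      show "card (insert y R0) < n" "l \<le> card (insert y R0)"
        using card card' less.prems(2) that by simp_all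
    qed
    have d_int: "d l \<in> val_ring val" if "l \<le> card R0" for l
    proof (rule less.IH[OF _ R0(1) _ d that])
      show "(R0, R) \<in> measures [card, \<lambda>R. card (R - {0..<card R})]"
        using card by simp
      show "card R0 < n" using card less.prems(2) by simp
    qed
    show ?thesis
    proof (cases "l = card R")
      case True
      then show ?thesis using less.prems(3) by (simp add: vanishing_coeffs_def)
    next
      case False
      have "vanishing_coeffs (insert x R0) c" using less.prems(3) R0(5) by simp
      obtain e where "e \<in> val_ring val" "\<And>l. l \<le> card R0 \<Longrightarrow> c l = c' l + e * d l"
        by (rule vanishing_coeffs_exchange[OF R0(1-4) \<open>vanishing_coeffs (insert x R0) c\<close> c' d]) blast
      moreover have "l \<le> card R0" using False less.prems(4) card by simp
      ultimately show ?thesis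
        using c'_int[OF less.prems(4)] d_int[of l] by (simp add: val_ring_add val_ring_mult)
    qed
  qed
qed

text \<open>Adding integral multiples of earlier rows makes each row from \<open>card S\<close> on
  vanish on \<open>S\<close>. The determinant is unchanged and splits into the minor of
  \<open>A\<close> at \<open>S\<close> and an integral block in the columns
  \<open>ds\<close>.\<close>

lemma col_det_integral_multiple:
  assumes S: "S \<subseteq> {0..<n}" and ds: "length ds = n - card S"
    and N: "\<And>i s. i < n \<Longrightarrow> s \<in> S \<Longrightarrow> N i s = A i s"
    and int: "\<And>i s. i < n \<Longrightarrow> s \<in> set ds \<Longrightarrow> N i s \<in> val_ring val"
  obtains g where "g \<in> val_ring val"
    "col_det n N (sorted_list_of_set S @ ds) = minor (card S) A S * g"
proof -
  let ?k = "card S" and ?ss = "sorted_list_of_set S"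
  have fin: "finite S" using S by (rule finite_sub)
  have kn: "?k \<le> n" using card_mono[OF _ S] by simp
  \<comment> \<open>\<open>S\<close> is padded to size \<open>i\<close>, because the vector with
    leading row \<open>i\<close> is fixed by vanishing at \<open>i\<close> places.\<close>
  have "\<exists>R. S \<subseteq> R \<and> R \<subseteq> {0..<n} \<and> card R = i" if "?k \<le> i" "i < n" for i
    by (rule exists_subset_between) (use that S in auto)
  then obtain R where R: "\<And>i. ?k \<le> i \<Longrightarrow> i < n \<Longrightarrow> S \<subseteq> R i \<and> R i \<subseteq> {0..<n} \<and> card (R i) = i"
    by metis
  have "\<exists>c. vanishing_coeffs (R i) c" if "?k \<le> i" "i < n" for i
    using R[OF that] ex_vanishing_coeffs[of "R i"] by blast
  then obtain c where c: "\<And>i. ?k \<le> i \<Longrightarrow> i < n \<Longrightarrow> vanishing_coeffs (R i) (c i)"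
    by metis
  define U where "U i j = (if i < ?k then if i = j then 1 else 0 else if j \<le> i then c i j else 0)" for i j
  have U_int: "U i j \<in> val_ring val" if "i < n" for i j
  proof (cases "?k \<le> i \<and> j \<le> i")
    case True
    then show ?thesis
      using vanishing_coeffs_integral[of "R i" "c i" j] R[of i] c[of i] that
      by (simp add: U_def)
  qed (auto simp: U_def)
  define N' where "N' i s = (\<Sum>l<n. U i l * N l s)" for i s
  have N'_upper: "N' i s = A i s" if "i < ?k" "s \<in> S" for i s
    using that kn N by (simp add: N'_def U_def if_distrib[of "\<lambda>x. x * _"] cong: if_cong)
  have N'_lower: "N' i s = 0" if "?k \<le> i" "i < n" "s \<in> S" for i s
  proof -
    have "N' i s = (\<Sum>l<n. U i l * A l s)"
      unfolding N'_def using N that by (intro sum.cong) auto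
    also have "\<dots> = (\<Sum>l<Suc i. U i l * A l s)"
      using that by (intro sum.mono_neutral_right) (auto simp: U_def)
    also have "\<dots> = (\<Sum>l<Suc i. c i l * A l s)"
      using that by (intro sum.cong) (auto simp: U_def)
    also have "\<dots> = 0"
    proof -
      have "s \<in> R i" "card (R i) = i" using R[OF that(1,2)] that(3) by auto
      then show ?thesis
        using c[OF that(1,2)] by (simp add: vanishing_coeffs_def del: sum.lessThan_Suc)
    qed
    finally show ?thesis .
  qed
  define g where "g = col_det (n - ?k) (\<lambda>i. N' (?k + i)) ds"
  have det_U: "Determinant.det (Matrix.mat n n (\<lambda>(i,j). U i j)) = 1"
  proof (rule det_unitriangular)
    show "U i i = 1" if "i < n" for i
      using c[of i] R[of i] that by (cases "i < ?k") (simp_all add: U_def vanishing_coeffs_def)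
  qed (auto simp: U_def)
  have eq1: "col_det n N' (?ss @ ds) = col_det n N (?ss @ ds)"
    unfolding N'_def using col_det_mult[of "?ss @ ds" n U N] ds kn det_U by simp
  have eq2: "col_det n N' (?ss @ ds) = col_det ?k N' ?ss * g"
    using col_det_block_lower_zero[of ?ss ?k ds "n - ?k" N'] N'_lower fin ds kn
    by (simp add: g_def)
  have eq3: "col_det ?k N' ?ss = minor ?k A S"
    unfolding minor_eq_col_det by (rule col_det_cong) (use N'_upper fin in auto)
  have eq: "col_det n N (?ss @ ds) = minor ?k A S * g"
    using eq1 eq2 eq3 by simp
  have g: "g \<in> val_ring val"
    unfolding g_def
  proof (rule val_ring_col_det[OF _ ds])
    fix i s assume "i < n - ?k" "s \<in> set ds"
    then have "U (?k + i) l * N l s \<in> val_ring val" if "l < n" for l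
      using that U_int[of "?k + i" l] int[of l s] by (intro val_ring_mult) simp_all
    then show "N' (?k + i) s \<in> val_ring val"
      unfolding N'_def by (intro val_ring_sum) simp
  qed
  show thesis by (rule that[OF g eq])
qed

text \<open>A maximal minor of the matrix extending \<open>A\<close> by entries \<open>t ^ 2 ^ prod_encode (i, c)\<close>,
  as a polynomial in \<open>t\<close>. Distinct sets of additional entries contribute distinct
  powers of \<open>t\<close>, by uniqueness of binary expansions.\<close>
definition generic_minor :: "nat set \<Rightarrow> 'a poly" where
  "generic_minor C = (let cs = sorted_list_of_set C in
     \<Sum>p | p permutes {..<n}. Polynomial.smult (of_int (sign p))
       (\<Prod>i<n. monom (if cs ! p i < n then A i (cs ! p i) else 1)
                   (if cs ! p i < n then 0 else 2 ^ prod_encode (i, cs ! p i))))"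

definition generic_matrix :: "'a \<Rightarrow> nat \<Rightarrow> nat \<Rightarrow> 'a" where
  "generic_matrix t i c = (if c < n then A i c else t ^ 2 ^ prod_encode (i, c))"

lemma poly_generic_minor: "poly (generic_minor C) t = minor n (generic_matrix t) C"
  unfolding generic_minor_def minor_def generic_matrix_def Let_def poly_sum
  by (intro sum.cong refl) (auto simp: poly_prod poly_monom intro!: prod.cong)

text \<open>The exponent is that of the identity permutation, which uses the new entries at
  \<open>(i, cs ! i)\<close> for \<open>card S \<le> i\<close>. The permutations with the same
  exponent are those fixing all these \<open>i\<close>; their terms form the Leibniz sum of
  \<open>minor (card S) A S\<close>.\<close>

lemma coeff_generic_minor:
  assumes S: "S \<subseteq> {0..<n}" and T: "T \<subseteq> {n..<2*n}" and card: "card S + card T = n"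
  shows "\<exists>e. coeff (generic_minor (S \<union> T)) e = minor (card S) A S"
proof -
  let ?k = "card S"
  have fin: "finite S" "finite T" using S T finite_subset by blast+
  define ss where "ss = sorted_list_of_set S"
  define cs where "cs = sorted_list_of_set (S \<union> T)"
  have cs: "cs = ss @ sorted_list_of_set T"
    unfolding cs_def ss_def
    by (rule sorted_list_of_set_Un_append[OF fin]) (use S T in \<open>meson atLeastLessThan_iff subsetD less_le_trans\<close>)
  have len: "length cs = n" "length ss = ?k" using card by (simp_all add: cs ss_def)
  have kn: "?k \<le> n" using card by simp
  have dist: "distinct cs" by (simp add: cs_def)
  have cs_low: "cs ! j < n" if "j < ?k" for j
  proof -
    have "cs ! j = ss ! j" "ss ! j \<in> S"
      using that len fin nth_mem[of j ss] by (auto simp: cs nth_append ss_def)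
    then show ?thesis using S by auto
  qed
  have cs_high: "\<not> cs ! j < n" if "?k \<le> j" "j < n" for j
  proof -
    have "cs ! j = sorted_list_of_set T ! (j - ?k)" using that len by (simp add: cs nth_append)
    moreover have "sorted_list_of_set T ! (j - ?k) \<in> T"
      using that card fin nth_mem[of "j - ?k" "sorted_list_of_set T"] by simp
    ultimately show ?thesis using T by auto
  qed
  have cs_iff: "cs ! j < n \<longleftrightarrow> j < ?k" if "j < n" for j
    using cs_low[of j] cs_high[of j] that by linarith
  \<comment> \<open>\<open>f p i\<close> codes the position used in row \<open>i\<close>, and
    \<open>J p\<close> collects the rows whose entry lies in a new column, so the exponent of
    \<open>p\<close> is the binary code of the image of \<open>J p\<close> under
    \<open>f p\<close>.\<close>
  define f where "f p i = prod_encode (i, cs ! p i)" for p :: "nat \<Rightarrow> nat" and i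
  define J where "J p = {i \<in> {..<n}. ?k \<le> p i}" for p
  define a where "a p i = (if cs ! p i < n then A i (cs ! p i) else 1)" for p i
  define b where "b p i = (if cs ! p i < n then 0 else 2 ^ prod_encode (i, cs ! p i) :: nat)" for p i
  define e where "e = set_encode (f id ` {?k..<n})"
  have p_less: "p i < n" if "p permutes {..<n}" "i < n" for p i
    using permutes_in_image[OF that(1), of i] that(2) by simp
  have inj_f: "inj_on (f p) I" for p I
    by (auto simp: inj_on_def f_def)
  have sum_b: "(\<Sum>i<n. b p i) = set_encode (f p ` J p)" if p: "p permutes {..<n}" for p
  proof -
    have "(\<Sum>i<n. b p i) = (\<Sum>i\<in>J p. 2 ^ f p i)"
      by (rule sum.mono_neutral_cong_right)
        (auto simp: J_def b_def f_def cs_iff p_less[OF p])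
    also have "\<dots> = set_encode (f p ` J p)"
      by (simp add: set_encode_def sum.reindex[OF inj_f] o_def)
    finally show ?thesis .
  qed
  have sum_b_eq: "(\<Sum>i<n. b p i) = e \<longleftrightarrow> (\<forall>i\<in>{?k..<n}. p i = i)" if p: "p permutes {..<n}" for p
  proof
    assume "(\<Sum>i<n. b p i) = e"
    then have "set_encode (f p ` J p) = set_encode (f id ` {?k..<n})"
      by (simp add: sum_b[OF p] e_def)
    moreover have "finite (f p ` J p)" by (simp add: J_def)
    ultimately have eq: "f p ` J p = f id ` {?k..<n}" by (simp add: set_encode_eq)
    show "\<forall>i\<in>{?k..<n}. p i = i"
    proof
      fix i assume i: "i \<in> {?k..<n}"
      then have "f id i \<in> f p ` J p" using eq by blast
      then have "cs ! p i = cs ! i" by (auto simp: f_def)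
      then show "p i = i"
        using i p_less[OF p, of i] dist len by (simp add: nth_eq_iff_index_eq)
    qed
  next
    assume fixed: "\<forall>i\<in>{?k..<n}. p i = i"
    \<comment> \<open>Injectivity keeps any index less than \<open>?k\<close> from being sent into
      the fixed range.\<close>
    have ge: "?k \<le> i" if "i < n" "?k \<le> p i" for i
    proof -
      have "p (p i) = p i" using fixed p_less[OF p that(1)] that(2) by simp
      then have "p i = i" using permutes_inj[OF p] by (simp add: inj_eq)
      then show ?thesis using that by simp
    qed
    have "J p = {?k..<n}"
    proof (intro equalityI subsetI)
      fix i assume "i \<in> J p"
      then have "i < n" "?k \<le> p i" by (simp_all add: J_def)
      with ge[of i] show "i \<in> {?k..<n}" by simp
    next
      fix i assume i: "i \<in> {?k..<n}"
      with fixed have "p i = i" by blast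
      with i show "i \<in> J p" by (simp add: J_def)
    qed
    moreover have "f p ` {?k..<n} = f id ` {?k..<n}"
      using fixed by (intro image_cong) (auto simp: f_def)
    ultimately show "(\<Sum>i<n. b p i) = e" by (simp add: sum_b[OF p] e_def)
  qed
  have perms: "{p. p permutes {..<n} \<and> (\<forall>i\<in>{?k..<n}. p i = i)} = {p. p permutes {..<?k}}"
  proof (intro equalityI subsetI; clarify)
    fix p assume p: "p permutes {..<n}" and fixed: "\<forall>i\<in>{?k..<n}. p i = i"
    show "p permutes {..<?k}"
    proof (rule permutes_superset[OF p])
      fix i assume "i \<in> {..<n} - {..<?k}"
      then have "i \<in> {?k..<n}" by simp
      with fixed show "p i = i" by blast
    qed
  next
    fix p assume p: "p permutes {..<?k}"
    then have "p permutes {..<n}" by (rule permutes_subset) (use kn in auto)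
    moreover have "p i = i" if "i \<in> {?k..<n}" for i
      using p that by (auto simp: permutes_def)
    ultimately show "p permutes {..<n} \<and> (\<forall>i\<in>{?k..<n}. p i = i)" by blast
  qed
  have "coeff (generic_minor (S \<union> T)) e
    = (\<Sum>p | p permutes {..<n}. of_int (sign p) * coeff (monom (\<Prod>i<n. a p i) (\<Sum>i<n. b p i)) e)"
    by (simp add: generic_minor_def Let_def cs_def[symmetric] coeff_sum prod_monom a_def b_def
        del: coeff_monom)
  also have "\<dots> = (\<Sum>p | p permutes {..<n}.
      if \<forall>i\<in>{?k..<n}. p i = i then of_int (sign p) * (\<Prod>i<n. a p i) else 0)"
    by (intro sum.cong refl) (simp add: sum_b_eq)
  also have "\<dots> = (\<Sum>p\<in>{p. p permutes {..<n} \<and> (\<forall>i\<in>{?k..<n}. p i = i)}.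
      of_int (sign p) * (\<Prod>i<n. a p i))"
    by (subst sum.inter_filter[symmetric]) (simp_all add: finite_permutations)
  also have "\<dots> = (\<Sum>p | p permutes {..<?k}. of_int (sign p) * (\<Prod>i<?k. A i (ss ! p i)))"
    unfolding perms
  proof (intro sum.cong refl arg_cong2[of _ _ _ _ "(*)"])
    fix p assume "p \<in> {p. p permutes {..<?k}}"
    then have p: "p permutes {..<?k}" by simp
    have low: "p i < ?k" if "i < ?k" for i
      using permutes_in_image[OF p, of i] that by simp
    have "(\<Prod>i<n. a p i) = (\<Prod>i<?k. a p i)"
    proof (rule prod.mono_neutral_right)
      show "\<forall>i\<in>{..<n} - {..<?k}. a p i = 1"
        using p cs_high by (auto simp: a_def permutes_def)
    qed (use kn in auto)
    also have "\<dots> = (\<Prod>i<?k. A i (ss ! p i))"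
      by (rule prod.cong) (use low cs_low len in \<open>auto simp: a_def cs nth_append\<close>)
    finally show "(\<Prod>i<n. a p i) = (\<Prod>i<?k. A i (ss ! p i))" .
  qed
  also have "\<dots> = minor ?k A S" by (simp add: minor_def ss_def)
  finally show ?thesis by blast
qed

text \<open>Genericity of \<open>t\<close> bounds the valuation of the minor above by that of its
  coefficient \<open>minor (card S) A S\<close>; being an integral multiple of the same element
  bounds it below.\<close>

lemma ex_generic_extension:
  assumes "infinite (residue_field val)"
  obtains N where "\<And>S T. S \<subseteq> {0..<n} \<Longrightarrow> T \<subseteq> {n..<2*n} \<Longrightarrow> card S + card T = n \<Longrightarrow>
    minor n N (S \<union> T) \<noteq> 0 \<and> val (minor n N (S \<union> T)) = val (minor (card S) A S)"
proof -
  define I where "I = {(S, T). S \<subseteq> {0..<n} \<and> T \<subseteq> {n..<2*n} \<and> card S + card T = n}"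
  define P where "P = (\<lambda>(S, T). generic_minor (S \<union> T)) ` I"
  have "I \<subseteq> Pow {0..<n} \<times> Pow {n..<2*n}" by (auto simp: I_def)
  then have "finite I" by (rule finite_subset) simp
  then have "finite P" by (simp add: P_def)
  moreover have "0 \<notin> P"
  proof
    assume "0 \<in> P"
    then obtain S T where ST: "(S, T) \<in> I" "generic_minor (S \<union> T) = 0"
      unfolding P_def by force
    then obtain e where "coeff (generic_minor (S \<union> T)) e = minor (card S) A S"
      using coeff_generic_minor[of S T] by (auto simp: I_def)
    then show False using minor_nonzero[of S] ST by (auto simp: I_def)
  qed
  ultimately have P: "finite P" "0 \<notin> P" .
  obtain t where t: "t \<in> val_ring val" "\<And>p. p \<in> P \<Longrightarrow> poly p t \<noteq> 0"
    "\<And>p i. p \<in> P \<Longrightarrow> coeff p i \<noteq> 0 \<Longrightarrow> val (poly p t) \<le> val (coeff p i)"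
    by (rule ex_generic_point[OF assms P]) blast
  have "minor n (generic_matrix t) (S \<union> T) \<noteq> 0 \<and>
      val (minor n (generic_matrix t) (S \<union> T)) = val (minor (card S) A S)"
    if S: "S \<subseteq> {0..<n}" and T: "T \<subseteq> {n..<2*n}" and card: "card S + card T = n" for S T
  proof -
    let ?m = "minor n (generic_matrix t) (S \<union> T)"
    have fin: "finite S" "finite T" using S T finite_subset by blast+
    have P: "generic_minor (S \<union> T) \<in> P" using that by (force simp: P_def I_def)
    have nz: "?m \<noteq> 0" using t(2)[OF P] by (simp add: poly_generic_minor)
    obtain e where e: "coeff (generic_minor (S \<union> T)) e = minor (card S) A S"
      using coeff_generic_minor[OF S T card] by blast
    then have le: "val ?m \<le> val (minor (card S) A S)"
      using t(3)[OF P, of e] minor_nonzero[OF S] by (simp add: poly_generic_minor)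
    have len: "length (sorted_list_of_set T) = n - card S" using card by simp
    have low: "generic_matrix t i s = A i s" if "s \<in> S" for i s
      using that S by (auto simp: generic_matrix_def)
    have high: "generic_matrix t i s \<in> val_ring val" if "s \<in> set (sorted_list_of_set T)" for i s
      using that T fin t(1) by (auto simp: generic_matrix_def intro: val_ring_power)
    obtain g where g: "g \<in> val_ring val"
      "col_det n (generic_matrix t) (sorted_list_of_set S @ sorted_list_of_set T) = minor (card S) A S * g"
      by (rule col_det_integral_multiple[OF S len low high])
    have "sorted_list_of_set (S \<union> T) = sorted_list_of_set S @ sorted_list_of_set T"
      by (rule sorted_list_of_set_Un_append[OF fin]) (use S T in \<open>meson atLeastLessThan_iff subsetD less_le_trans\<close>)
    then have m: "?m = minor (card S) A S * g" using g(2) by (simp add: minor_eq_col_det)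
    then have "g \<noteq> 0" using nz by auto
    then have "val (minor (card S) A S) \<le> val ?m"
      using g(1) minor_nonzero[OF S] unfolding m by (simp add: val_mult val_ring_def)
    with le nz show ?thesis by simp
  qed
  then show thesis by (rule that)
qed

end

section \<open>The three-term Pluecker relation under the valuation\<close>

context valued_field
begin

text \<open>After a change of the rows the columns \<open>zs @ [k, l]\<close> form an identity matrix;
  then all six minors of the Pluecker relation are determined by the last two rows.\<close>
lemma val_three_term_pluecker:
  fixes M :: "nat \<Rightarrow> nat \<Rightarrow> 'a"
  assumes Z: "finite Z" "card Z = m" and ijkl: "distinct [i, j, k, l]" "{i, j, k, l} \<inter> Z = {}"
    and nz: "\<And>u v. u \<in> {i, j, k, l} \<Longrightarrow> v \<in> {i, j, k, l} \<Longrightarrow> u \<noteq> v \<Longrightarrow>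
      minor (Suc (Suc m)) M (insert u (insert v Z)) \<noteq> 0"
  defines "w \<equiv> \<lambda>u v. val (minor (Suc (Suc m)) M (insert u (insert v Z)))"
  shows "min (w i k + w j l) (w i l + w j k) \<le> w i j + w k l"
proof -
  let ?n = "Suc (Suc m)"
  let ?zs = "sorted_list_of_set Z"
  let ?kl = "?zs @ [k, l]"
  have len: "length (?zs @ [u, v]) = ?n" for u v using Z by simp
  have nz': "col_det ?n M (?zs @ [u, v]) \<noteq> 0" "val (col_det ?n M (?zs @ [u, v])) = w u v"
    if "u \<in> {i, j, k, l}" "v \<in> {i, j, k, l}" "u \<noteq> v" for u v
  proof -
    have d: "distinct (?zs @ [u, v])" and s: "set (?zs @ [u, v]) = insert u (insert v Z)"
      using that ijkl Z by auto
    show "col_det ?n M (?zs @ [u, v]) \<noteq> 0"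
      using col_det_eq_minor_or_neg[OF d len, of M] nz[OF that] unfolding s by auto
    show "val (col_det ?n M (?zs @ [u, v])) = w u v"
      using val_col_det[OF d len, of M] unfolding s w_def .
  qed
  have in4: "i \<in> {i, j, k, l}" "j \<in> {i, j, k, l}" "k \<in> {i, j, k, l}" "l \<in> {i, j, k, l}"
    by simp_all
  have ne: "i \<noteq> j" "i \<noteq> k" "i \<noteq> l" "j \<noteq> k" "j \<noteq> l" "k \<noteq> l" using ijkl by auto
  obtain B where B: "\<And>a b. a < ?n \<Longrightarrow> b < ?n \<Longrightarrow> (\<Sum>c<?n. B a c * M c (?kl ! b)) = (if a = b then 1 else 0)"
    using nz'(1)[OF in4(3,4) ne(6)] by (rule col_det_inverse) blast
  define N where "N a c = (\<Sum>b<?n. B a b * M b c)" for a c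
  define d where "d = Determinant.det (Matrix.mat ?n ?n (\<lambda>(a,b). B a b))"
  have N_zs: "N a (?zs ! b) = (if a = b then 1 else 0)" if "a < ?n" "b < m" for a b
    using B[of a b] that Z unfolding N_def by (simp add: nth_append del: sum.lessThan_Suc)
  have N_kl: "N a k = (if a = m then 1 else 0)" "N a l = (if a = Suc m then 1 else 0)" if "a < ?n" for a
    using B[of a m] B[of a "Suc m"] that Z unfolding N_def
    by (simp_all add: nth_append del: sum.lessThan_Suc)
  have N_lower: "N a c = 0" if "m \<le> a" "a < m + Suc (Suc 0)" and c: "c \<in> set ?zs" for a c
  proof -
    from c obtain b where "b < length ?zs" "c = ?zs ! b" by (auto simp: in_set_conv_nth)
    then show ?thesis using N_zs[of a b] that(1,2) Z by simp
  qed
  have N_one: "col_det m N ?zs = 1"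
  proof -
    have "Matrix.mat m m (\<lambda>(a, b). N a (?zs ! b)) = 1\<^sub>m m"
      by (rule eq_matI) (use N_zs in auto)
    then show ?thesis by (simp add: col_det_def)
  qed
  have N_det: "d * col_det ?n M (?zs @ [u, v]) = N m u * N (Suc m) v - N m v * N (Suc m) u" for u v
  proof -
    have "col_det (m + Suc (Suc 0)) N (?zs @ [u, v])
      = col_det m N ?zs * col_det (Suc (Suc 0)) (\<lambda>a. N (m + a)) [u, v]"
      by (rule col_det_block_lower_zero) (use Z N_lower in auto)
    moreover have "col_det ?n N (?zs @ [u, v]) = d * col_det ?n M (?zs @ [u, v])"
      unfolding N_def d_def by (rule col_det_mult[OF len])
    ultimately show ?thesis by (simp add: N_one col_det_2)
  qed
  have "d * col_det ?n M ?kl = 1" using N_det[of k l] N_kl[of m] N_kl[of "Suc m"] by simp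
  then have d: "d \<noteq> 0" by auto
  have val_N: "val (N m u * N (Suc m) v - N m v * N (Suc m) u) = val d + w u v"
    "N m u * N (Suc m) v - N m v * N (Suc m) u \<noteq> 0"
    if "u \<in> {i, j, k, l}" "v \<in> {i, j, k, l}" "u \<noteq> v" for u v
    unfolding N_det[symmetric] using nz'[OF that] d by (simp_all add: val_mult)
  \<comment> \<open>In the columns \<open>k\<close>, \<open>l\<close> the last two rows form the
    identity, which determines the valuation of the common factor \<open>d\<close>.\<close>
  have kl: "val d + w k l = 0"
    using val_N(1)[OF in4(3,4) ne(6)] N_kl[of m] N_kl[of "Suc m"] by simp
  have entries: "N m u \<noteq> 0" "val (N m u) = val d + w u l"
      "N (Suc m) u \<noteq> 0" "val (N (Suc m) u) = val d + w u k"
    if "u \<in> {i, j, k, l}" "u \<noteq> k" "u \<noteq> l" for u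
    using val_N[OF that(1) in4(4) that(3)] val_N[OF that(1) in4(3) that(2)]
      N_kl[of m] N_kl[of "Suc m"] by simp_all
  note ei = entries[OF in4(1) ne(2,3)] and ej = entries[OF in4(2) ne(4,5)]
  \<comment> \<open>The ultrametric inequality enters here: up to the factor \<open>d\<close>, the
    minor at \<open>i\<close>, \<open>j\<close> is a difference of products of entries, and each
    entry is up to sign and \<open>d\<close> a minor involving \<open>k\<close> or
    \<open>l\<close>.\<close>
  have "min (val (N m i * N (Suc m) j)) (val (- (N m j * N (Suc m) i)))
    \<le> val (N m i * N (Suc m) j + - (N m j * N (Suc m) i))"
    by (rule val_add) (use ei ej val_N(2)[OF in4(1,2) ne(1)] in auto)
  then have "min (val d + w i l + (val d + w j k)) (val d + w j l + (val d + w i k)) \<le> val d + w i j"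
    using val_N(1)[OF in4(1,2) ne(1)] ei ej by (simp add: val_mult)
  then show ?thesis using kl by linarith
qed

end

subsection \<open>Grassmannian and flag variety\<close>

text \<open>Locally, marginal gains decrease when one element is added. Iteration gives decreasing
  marginals over any set \<open>D\<close>, and adding up the gains of the elements of
  \<open>T - S\<close> gives submodularity.\<close>

lemma local_submodular_imp_SUBMOD:
  assumes "\<And>R x y. R \<subseteq> {0..<n} \<Longrightarrow> x \<in> {0..<n} - R \<Longrightarrow> y \<in> {0..<n} - R \<Longrightarrow> x \<noteq> y \<Longrightarrow>
    F R + F (insert x (insert y R)) \<le> F (insert x R) + F (insert y R)"
  shows "F \<in> SUBMOD n"
proof -
  have marginal: "F (insert x (R \<union> D)) - F (R \<union> D) \<le> F (insert x R) - F R"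
    if "finite D" "R \<union> D \<subseteq> {0..<n}" "x \<in> {0..<n} - (R \<union> D)" for x R D
    using that
  proof (induction D)
    case (insert d D)
    have IH: "F (insert x (R \<union> D)) - F (R \<union> D) \<le> F (insert x R) - F R"
      using insert.prems by (intro insert.IH) auto
    show ?case
    proof (cases "d \<in> R")
      case True
      then have "R \<union> insert d D = R \<union> D" by blast
      then show ?thesis using IH by simp
    next
      case False
      have "F (R \<union> D) + F (insert x (insert d (R \<union> D))) \<le> F (insert x (R \<union> D)) + F (insert d (R \<union> D))"
        using insert.prems insert.hyps False by (intro assms) auto
      then show ?thesis using IH by simp
    qed
  qed simp
  have union: "F (S \<union> E) - F S \<le> F (R \<union> E) - F R"
    if "finite E" "R \<subseteq> S" "S \<union> E \<subseteq> {0..<n}" "E \<inter> S = {}" for E R S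
    using that
  proof (induction E)
    case (insert e E)
    have IH: "F (S \<union> E) - F S \<le> F (R \<union> E) - F R"
      using insert.prems by (intro insert.IH) auto
    have eq: "R \<union> E \<union> S = S \<union> E" using insert.prems by blast
    have "finite S" using insert.prems(2) finite_subset by blast
    then have "F (insert e (R \<union> E \<union> S)) - F (R \<union> E \<union> S) \<le> F (insert e (R \<union> E)) - F (R \<union> E)"
      using insert.prems insert.hyps by (intro marginal) auto
    then show ?case using IH by (simp add: eq)
  qed simp
  have "F (S \<inter> T) + F (S \<union> T) \<le> F S + F T" if "S \<subseteq> {0..<n}" "T \<subseteq> {0..<n}" for S T
  proof -
    have "finite (T - S)" using that finite_subset by blast
    then have "F (S \<union> (T - S)) - F S \<le> F ((S \<inter> T) \<union> (T - S)) - F (S \<inter> T)"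
      by (rule union) (use that in blast)+
    moreover have "S \<union> (T - S) = S \<union> T" "(S \<inter> T) \<union> (T - S) = T" by blast+
    ultimately show ?thesis by simp
  qed
  then show ?thesis by (simp add: SUBMOD_def)
qed

text \<open>Row reduce a matrix so that the last \<open>n\<close> columns become the antidiagonal identity.
  Then the first \<open>k\<close> rows span the vectors of the row space that vanish on
  \<open>{n..<2*n-k}\<close>, so that the first \<open>n\<close> columns form a basis adapted to a flag.\<close>
lemma Gr_imp_Fl:
  fixes x :: "nat set \<Rightarrow> 'a::field"
  assumes "x \<in> Gr n" and nz: "\<And>C. C \<in> Gr_idx n \<Longrightarrow> x C \<noteq> 0"
  shows "(\<lambda>S. if S \<subseteq> {0..<n} then x (S \<union> {n..<n + (n - card S)}) else 0) \<in> Fl n"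
proof -
  obtain M where x: "x = (\<lambda>C. if C \<in> Gr_idx n then minor n M C else 0)"
    using assms(1) unfolding Gr_def by blast
  let ?cs = "rev [n..<2*n]"
  have "{n..<2*n} \<in> Gr_idx n" by (auto simp: Gr_idx_def)
  then have "minor n M (set ?cs) \<noteq> 0" using nz[of "{n..<2*n}"] by (simp add: x)
  then have "col_det n M ?cs \<noteq> 0" using col_det_eq_minor_or_neg[of ?cs n M] by auto
  then obtain B where B: "\<And>i j. i < n \<Longrightarrow> j < n \<Longrightarrow> (\<Sum>l<n. B i l * M l (?cs ! j)) = (if i = j then 1 else 0)"
    by (rule col_det_inverse) blast
  define N where "N i c = (\<Sum>l<n. B i l * M l c)" for i c
  define d where "d = Determinant.det (Matrix.mat n n (\<lambda>(i,j). B i j))"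
  have N_det: "col_det n N cs = d * col_det n M cs" if "length cs = n" for cs
    unfolding N_def d_def by (rule col_det_mult[OF that])
  have "Matrix.mat n n (\<lambda>(i,j). N i (?cs ! j)) = 1\<^sub>m n"
    by (rule eq_matI) (use B in \<open>auto simp: N_def\<close>)
  then have "col_det n N ?cs = 1" by (simp add: col_det_def)
  then have d: "d \<noteq> 0" using N_det[of ?cs] by auto
  have N_zero: "N i c = 0" if "i < k" "k \<le> n" "n \<le> c" "c < 2*n - k" for i c k
  proof -
    have "?cs ! (2*n - 1 - c) = c" using that by (simp add: rev_nth)
    then show ?thesis using B[of i "2*n - 1 - c"] that by (simp add: N_def)
  qed
  \<comment> \<open>The complementary block depends on \<open>S\<close> only through its size, so
    divided by \<open>d\<close> it serves as the scalar on level \<open>k\<close>.\<close>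
  define J where "J k = col_det (n - k) (\<lambda>i. N (k + i)) (sorted_list_of_set {n..<n + (n - k)})" for k
  have x_eq: "d * x (S \<union> {n..<n + (n - card S)}) = minor (card S) N S * J (card S)"
    and x_nz: "x (S \<union> {n..<n + (n - card S)}) \<noteq> 0" if S: "S \<subseteq> {0..<n}" for S
  proof -
    let ?k = "card S" and ?T = "{n..<n + (n - card S)}"
    have fin: "finite S" using S finite_subset by blast
    have k: "?k \<le> n" using card_mono[OF _ S] by simp
    have "S \<inter> ?T = {}" using S by auto
    then have "card (S \<union> ?T) = n" using k fin by (simp add: card_Un_disjoint)
    then have C: "S \<union> ?T \<in> Gr_idx n" using S k by (auto simp: Gr_idx_def)
    then show "x (S \<union> ?T) \<noteq> 0" by (rule nz)
    have sorted: "sorted_list_of_set (S \<union> ?T) = sorted_list_of_set S @ sorted_list_of_set ?T"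
      by (rule sorted_list_of_set_Un_append[OF fin])
        (use S in \<open>auto dest!: subsetD\<close>)
    have "d * x (S \<union> ?T) = col_det n N (sorted_list_of_set S @ sorted_list_of_set ?T)"
    proof -
      have "x (S \<union> ?T) = col_det n M (sorted_list_of_set S @ sorted_list_of_set ?T)"
        using C unfolding x minor_eq_col_det sorted by simp
      moreover have "length (sorted_list_of_set S @ sorted_list_of_set ?T) = n" using k by simp
      ultimately show ?thesis by (simp only: N_det)
    qed
    also have "\<dots> = col_det (?k + (n - ?k)) N (sorted_list_of_set S @ sorted_list_of_set ?T)"
      using k by simp
    also have "\<dots> = col_det ?k N (sorted_list_of_set S) * J ?k"
      unfolding J_def by (rule col_det_block_upper_zero) (use N_zero[of _ ?k] k in auto)
    finally show "d * x (S \<union> ?T) = minor ?k N S * J ?k" by (simp add: minor_eq_col_det)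
  qed
  \<comment> \<open>Initial segments as test sets show that neither factor vanishes.\<close>
  have init: "minor k N {0..<k} \<noteq> 0" "J k \<noteq> 0" if "k \<le> n" for k
    using x_eq[of "{0..<k}"] x_nz[of "{0..<k}"] that d by auto
  have "rows_indep k n N" if "k \<le> n" for k
    unfolding rows_indep_def
  proof (intro allI impI)
    fix c i assume c: "\<forall>j<n. (\<Sum>i<k. c i * N i j) = 0" and i: "i < k"
    show "c i = 0"
      by (rule minor_kernel_trivial[OF init(1)[OF that] _ _ _ i]) (use c that in auto)
  qed
  moreover have "row_span k n N \<subseteq> row_span (Suc k) n N" for k
  proof
    fix v assume "v \<in> row_span k n N"
    then obtain c where c: "v = (\<lambda>j. if j < n then (\<Sum>i<k. c i * N i j) else 0)"
      unfolding row_span_def by blast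
    have "v = (\<lambda>j. if j < n then (\<Sum>i<Suc k. (c(k := 0)) i * N i j) else 0)"
      unfolding c by (rule ext) simp
    then show "v \<in> row_span (Suc k) n N" unfolding row_span_def by blast
  qed
  moreover have "(\<lambda>S. if S \<subseteq> {0..<n} then x (S \<union> {n..<n + (n - card S)}) else 0)
    = (\<lambda>S. if S \<subseteq> {0..<n} then J (card S) / d * minor (card S) N S else 0)"
    using x_eq d by (intro ext) (simp add: field_simps)
  ultimately show ?thesis
    using init d unfolding Fl_def
    by (intro CollectI exI[of _ "\<lambda>_. N"] exI[of _ "\<lambda>k. J k / d"]) simp
qed

lemma row_span_mono:
  fixes M :: "nat \<Rightarrow> nat \<Rightarrow> nat \<Rightarrow> 'a::field"
  assumes "\<And>k. k < n \<Longrightarrow> row_span k n (M k) \<subseteq> row_span (Suc k) n (M (Suc k))" "i \<le> k" "k \<le> n"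
  shows "row_span i n (M i) \<subseteq> row_span k n (M k)"
  using assms(2,3)
proof (induction k rule: dec_induct)
  case (step m)
  then show ?case using assms(1)[of m] by fastforce
qed simp

text \<open>Member \<open>i + 1\<close> of the flag contains a vector vanishing on \<open>{0..<i}\<close>, and its entry at
  \<open>i\<close> can be prescribed; the choice below makes all minors agree with \<open>q\<close> up to \<open>q {}\<close>.\<close>
lemma Fl_upper_triangular:
  fixes q :: "nat set \<Rightarrow> 'a::field"
  assumes "q \<in> Fl n" and nz: "\<And>S. S \<subseteq> {0..<n} \<Longrightarrow> q S \<noteq> 0"
  obtains A where "\<And>i j. i < n \<Longrightarrow> j < i \<Longrightarrow> A i j = 0"
    "\<And>S. S \<subseteq> {0..<n} \<Longrightarrow> q S = q {} * minor (card S) A S"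
proof -
  obtain M c where c: "\<And>k. k \<le> n \<Longrightarrow> c k \<noteq> 0"
    and nested: "\<And>k. k < n \<Longrightarrow> row_span k n (M k) \<subseteq> row_span (Suc k) n (M (Suc k))"
    and q: "q = (\<lambda>S. if S \<subseteq> {0..<n} then c (card S) * minor (card S) (M (card S)) S else 0)"
    using assms(1) unfolding Fl_def by blast
  have M_nz: "minor (card S) (M (card S)) S \<noteq> 0" if "S \<subseteq> {0..<n}" for S
    using nz[OF that] that by (auto simp: q)
  \<comment> \<open>With these diagonal entries the minors at initial segments telescope to
    \<open>q {0..<k} / q {}\<close>.\<close>
  have "\<exists>a. \<forall>s\<in>{0..<Suc i}. (\<Sum>l<Suc i. a l * M (Suc i) l s)
      = (if s = i then q {0..<Suc i} / q {0..<i} else 0)" if "i < n" for i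
  proof -
    have "minor (Suc i) (M (Suc i)) {0..<Suc i} \<noteq> 0" using M_nz[of "{0..<Suc i}"] that by simp
    then obtain a where "\<And>s. s \<in> {0..<Suc i} \<Longrightarrow> (\<Sum>l<Suc i. a l * M (Suc i) l s)
      = (if s = i then q {0..<Suc i} / q {0..<i} else 0)"
      by (rule minor_solve[of "Suc i" "M (Suc i)" "{0..<Suc i}"
          "\<lambda>s. if s = i then q {0..<Suc i} / q {0..<i} else 0"]) auto
    then show ?thesis by blast
  qed
  then obtain a where a: "\<And>i. i < n \<Longrightarrow> \<forall>s\<in>{0..<Suc i}. (\<Sum>l<Suc i. a i l * M (Suc i) l s)
      = (if s = i then q {0..<Suc i} / q {0..<i} else 0)"
    by metis
  define A where "A i s = (\<Sum>l<Suc i. a i l * M (Suc i) l s)" for i s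
  have A_low: "A i s = 0" if "i < n" "s < i" for i s
    using a[OF that(1)] that(2) by (simp add: A_def del: sum.lessThan_Suc)
  have A_diag: "A i i = q {0..<Suc i} / q {0..<i}" if "i < n" for i
    using a[OF that] by (simp add: A_def del: sum.lessThan_Suc)
  have A_init: "minor k A {0..<k} = q {0..<k} / q {}" if "k \<le> n" for k
    using that
  proof (induction k)
    case 0
    then show ?case using nz[of "{}"] by (simp add: minor_eq_col_det col_det_0)
  next
    case (Suc k)
    have "minor (Suc k) A {0..<Suc k} = col_det (k + Suc 0) A ([0..<k] @ [k])"
      by (simp add: minor_eq_col_det)
    also have "\<dots> = col_det k A [0..<k] * col_det (Suc 0) (\<lambda>i. A (k + i)) [k]"
      by (rule col_det_block_lower_zero) (use Suc.prems A_low in auto)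
    also have "\<dots> = minor k A {0..<k} * A k k"
      by (simp add: minor_eq_col_det col_det_1)
    also have "\<dots> = q {0..<Suc k} / q {}"
      using Suc A_diag[of k] nz[of "{0..<k}"] by simp
    finally show ?case .
  qed
  have "\<exists>u. \<forall>s<n. A i s = (\<Sum>l<k. u l * M k l s)" if "i < k" "k \<le> n" for i k
  proof -
    have "(\<lambda>s. if s < n then A i s else 0) \<in> row_span (Suc i) n (M (Suc i))"
      unfolding row_span_def A_def by blast
    also have "\<dots> \<subseteq> row_span k n (M k)"
      by (rule row_span_mono[OF nested]) (use that in auto)
    finally obtain u where "(\<lambda>s. if s < n then A i s else 0)
        = (\<lambda>s. if s < n then \<Sum>l<k. u l * M k l s else 0)"
      unfolding row_span_def by blast
    then have "\<forall>s<n. A i s = (\<Sum>l<k. u l * M k l s)" by (metis (no_types, lifting))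
    then show ?thesis by blast
  qed
  then obtain u where u: "\<And>i k s. i < k \<Longrightarrow> k \<le> n \<Longrightarrow> s < n \<Longrightarrow> A i s = (\<Sum>l<k. u i k l * M k l s)"
    by metis
  define D where "D k = Determinant.det (Matrix.mat k k (\<lambda>(i,j). u i k j))" for k
  have minor_D: "c (card S) * minor (card S) A S = D (card S) * q S" if S: "S \<subseteq> {0..<n}" for S
  proof -
    let ?k = "card S" and ?ss = "sorted_list_of_set S"
    have fin: "finite S" using S finite_subset by blast
    have k: "?k \<le> n" using card_mono[OF _ S] by simp
    have "minor ?k A S = col_det ?k (\<lambda>i s. \<Sum>l<?k. u i ?k l * M ?k l s) ?ss"
      unfolding minor_eq_col_det
    proof (rule col_det_cong)
      fix i s assume "i < ?k" "s \<in> set ?ss"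
      then show "A i s = (\<Sum>l<?k. u i ?k l * M ?k l s)"
        using u[of i ?k s] k S fin by auto
    qed simp
    also have "\<dots> = D ?k * minor ?k (M ?k) S"
      unfolding D_def minor_eq_col_det by (rule col_det_mult) simp
    finally show ?thesis using S by (simp add: q)
  qed
  \<comment> \<open>The factor \<open>D k\<close> is common to all sets of size \<open>k\<close>, so
    one initial segment determines it.\<close>
  have D: "c k = q {} * D k" if "k \<le> n" for k
    using minor_D[of "{0..<k}"] A_init[OF that] nz[of "{0..<k}"] nz[of "{}"] that
    by (simp add: field_simps)
  have "q S = q {} * minor (card S) A S" if S: "S \<subseteq> {0..<n}" for S
  proof -
    have k: "card S \<le> n" using card_mono[OF _ S] by simp
    have "D (card S) \<noteq> 0" using D[OF k] c[OF k] by auto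
    moreover have "D (card S) * (q {} * minor (card S) A S) = D (card S) * q S"
      using minor_D[OF S] unfolding D[OF k] by (simp add: algebra_simps)
    ultimately show ?thesis by simp
  qed
  with A_low show thesis by (rule that)
qed

section \<open>Identification of \<open>Lspace\<close> with set functions\<close>

lemma completion_in_Gr_idx:
  assumes "S \<subseteq> {0..<n}"
  shows "S \<union> {n..<n + (n - card S)} \<in> Gr_idx n"
proof -
  have fin: "finite S" using assms finite_subset by blast
  have k: "card S \<le> n" using card_mono[OF _ assms] by simp
  have "S \<inter> {n..<n + (n - card S)} = {}" using assms by auto
  then have "card (S \<union> {n..<n + (n - card S)}) = n" using fin k by (simp add: card_Un_disjoint)
  then show ?thesis using assms k by (auto simp: Gr_idx_def)
qed

lemma completion_Int: "S \<subseteq> {0..<n} \<Longrightarrow> (S \<union> {n..<m}) \<inter> {0..<n} = S" for n m :: nat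
  by auto

lemma Lspace_eq_phi:
  assumes "p \<in> Lspace n" "C \<in> Gr_idx n"
  shows "p C = phi n p (C \<inter> {0..<n})"
proof -
  let ?S = "C \<inter> {0..<n}"
  have "?S \<union> {n..<n + (n - card ?S)} \<in> Gr_idx n" by (rule completion_in_Gr_idx) blast
  moreover have "(?S \<union> {n..<n + (n - card ?S)}) \<inter> {0..<n} = C \<inter> {0..<n}"
    by (rule completion_Int) blast
  ultimately have "p C = p (?S \<union> {n..<n + (n - card ?S)})"
    using assms unfolding Lspace_def by blast
  then show ?thesis by (simp add: phi_def)
qed

text \<open>The inverse identification; the value 0 outside \<open>Gr_idx n\<close> matches the
  convention of \<open>nu\<close>.\<close>

definition psi :: "nat \<Rightarrow> (nat set \<Rightarrow> real) \<Rightarrow> nat set \<Rightarrow> real" where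
  "psi n F C = (if C \<in> Gr_idx n then F (C \<inter> {0..<n}) else 0)"

lemma psi_in_Lspace: "psi n F \<in> Lspace n"
  by (auto simp: Lspace_def psi_def)

lemma phi_psi:
  assumes "\<And>S. \<not> S \<subseteq> {0..<n} \<Longrightarrow> F S = 0"
  shows "phi n (psi n F) = F"
proof
  fix S show "phi n (psi n F) S = F S"
    using assms completion_in_Gr_idx[of S n] completion_Int[of S n]
    by (cases "S \<subseteq> {0..<n}") (simp_all add: phi_def psi_def)
qed

text \<open>As all orders of \<open>i, j, k, l\<close> are covered, each of the three sums is at
  most the maximum of the other two, so the maximum is attained twice. It is \<open>max\<close>
  since \<open>nu\<close> negates \<open>val\<close>; weak inequalities survive closure.\<close>

definition tropical_pluecker :: "nat \<Rightarrow> (nat set \<Rightarrow> real) \<Rightarrow> bool" where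
  "tropical_pluecker n p \<longleftrightarrow> (\<forall>Z i j k l. Suc (Suc (card Z)) = n \<longrightarrow> Z \<union> {i, j, k, l} \<subseteq> {0..<2*n} \<longrightarrow>
     distinct [i, j, k, l] \<longrightarrow> {i, j, k, l} \<inter> Z = {} \<longrightarrow>
     p (insert i (insert j Z)) + p (insert k (insert l Z))
     \<le> max (p (insert i (insert k Z)) + p (insert j (insert l Z)))
           (p (insert i (insert l Z)) + p (insert j (insert k Z))))"

text \<open>The relation is applied to \<open>x\<close>, \<open>y\<close> and two columns of the
  second half. On \<open>Lspace\<close> the latter are interchangeable, so both sums under the
  maximum agree and local submodularity remains.\<close>

lemma tropical_pluecker_Lspace_imp_SUBMOD:
  assumes "tropical_pluecker n p" "p \<in> Lspace n"
  shows "phi n p \<in> SUBMOD n"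
proof (rule local_submodular_imp_SUBMOD)
  fix R x y
  assume R: "R \<subseteq> {0..<n}" and x: "x \<in> {0..<n} - R" and y: "y \<in> {0..<n} - R" and xy: "x \<noteq> y"
  have fin: "finite R" using R finite_subset by blast
  have "card (insert x (insert y R)) \<le> card {0..<n}"
    by (rule card_mono) (use R x y in auto)
  then have card: "Suc (Suc (card R)) \<le> n" using fin x y xy by simp
  \<comment> \<open>\<open>Z\<close> needs \<open>n - 2\<close> elements: the padding
    \<open>{n..<a}\<close> supplies those not in \<open>R\<close>, and \<open>a\<close>,
    \<open>Suc a\<close> are the next two columns.\<close>
  define a where "a = n + (n - Suc (Suc (card R)))"
  define Z where "Z = R \<union> {n..<a}"
  have a: "n \<le> a" "Suc a < 2 * n" using card by (auto simp: a_def)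
  have disj: "R \<inter> {n..<a} = {}" using R by auto
  then have cardZ: "Suc (Suc (card Z)) = n"
    using fin card by (simp add: Z_def card_Un_disjoint a_def)
  have finZ: "finite Z" using fin by (simp add: Z_def)
  have Z_sub: "Z \<subseteq> {0..<2*n}" using R a by (auto simp: Z_def)
  have nin: "x \<notin> Z" "y \<notin> Z" "a \<notin> Z" "Suc a \<notin> Z" "x < n" "y < n"
    using R x y a by (auto simp: Z_def)
  have ZR: "Z \<inter> {0..<n} = R" using R by (auto simp: Z_def)
  have p: "p (insert u (insert v Z)) = phi n p (insert u (insert v Z) \<inter> {0..<n})"
    if "u \<noteq> v" "u \<notin> Z" "v \<notin> Z" "u < 2*n" "v < 2*n" for u v
    by (rule Lspace_eq_phi[OF assms(2)])
      (use that cardZ finZ Z_sub in \<open>auto simp: Gr_idx_def\<close>)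
  have "p (insert x (insert y Z)) + p (insert a (insert (Suc a) Z))
     \<le> max (p (insert x (insert a Z)) + p (insert y (insert (Suc a) Z)))
           (p (insert x (insert (Suc a) Z)) + p (insert y (insert a Z)))"
    using assms(1)[unfolded tropical_pluecker_def, rule_format, of Z x y a "Suc a"]
      cardZ Z_sub nin a xy by auto
  then show "phi n p R + phi n p (insert x (insert y R))
      \<le> phi n p (insert x R) + phi n p (insert y R)"
    using nin a xy by (simp add: p ZR insert_commute)
qed

lemma closed_tropical_pluecker: "closed {p. tropical_pluecker n p}"
proof -
  have cont: "continuous_on UNIV (\<lambda>p :: nat set \<Rightarrow> real. p C)" for C
    by (rule continuous_on_product_coordinates)
  show ?thesis
    unfolding tropical_pluecker_def
    by (intro closed_Collect_all closed_Collect_imp open_Collect_const closed_Collect_le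
        continuous_intros cont)
qed

section \<open>Images under the valuation and their closures, coordinate by coordinate\<close>

lemma nuI:
  assumes "x \<in> X" "\<forall>C\<in>I. x C \<noteq> 0" "F = (\<lambda>C. if C \<in> I then - val (x C) else 0)"
  shows "F \<in> nu I val X"
  using assms unfolding nu_def by blast

lemma nu_outside: "F \<in> nu I val X \<Longrightarrow> C \<notin> I \<Longrightarrow> F C = 0"
  by (auto simp: nu_def)

lemma closure_nu_outside:
  assumes "F \<in> closure (nu I val X)" "C \<notin> I"
  shows "F C = 0"
proof -
  have "closed {F :: nat set \<Rightarrow> real. F C = 0}"
    by (intro closed_Collect_eq continuous_on_product_coordinates continuous_on_const)
  moreover have "nu I val X \<subseteq> {F. F C = 0}" using nu_outside[OF _ assms(2)] by blast
  ultimately have "closure (nu I val X) \<subseteq> {F. F C = 0}" by (rule closure_minimal[rotated])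
  then show ?thesis using assms(1) by blast
qed

text \<open>Strict bounds on finitely many coordinates define an open set of the product topology,
  which is where finiteness of \<open>I\<close> enters.\<close>

lemma closure_approachable_coordinates:
  fixes X :: "('b \<Rightarrow> real) set"
  assumes "F \<in> closure X" "finite I" "\<delta> > 0"
  obtains G where "G \<in> X" "\<And>i. i \<in> I \<Longrightarrow> \<bar>G i - F i\<bar> < \<delta>"
proof -
  let ?U = "\<Inter>i\<in>I. {G. \<bar>G i - F i\<bar> < \<delta>}"
  have "open ?U"
    using assms(2) by (intro open_INT ballI open_Collect_less continuous_intros
        continuous_on_product_coordinates)
  moreover have "F \<in> ?U" using assms(3) by simp
  ultimately have "?U \<inter> X \<noteq> {}"
    using assms(1) open_Int_closure_eq_empty[of ?U X] by blast
  then show thesis using that by blast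
qed

lemma in_closureI_coordinates:
  fixes X :: "('b \<Rightarrow> real) set"
  assumes "\<And>\<delta>. \<delta> > 0 \<Longrightarrow> \<exists>G\<in>X. \<forall>i. \<bar>G i - F i\<bar> < \<delta>"
  shows "F \<in> closure X"
proof -
  have "\<exists>G\<in>X. \<forall>i. \<bar>G i - F i\<bar> < inverse (real (Suc m))" for m
    by (rule assms) simp
  then obtain G where G: "\<And>m. G m \<in> X" "\<And>m i. \<bar>G m i - F i\<bar> < inverse (real (Suc m))"
    by metis
  have "(\<lambda>m. G m i) \<longlonglongrightarrow> F i" for i
  proof (rule LIMSEQ_I)
    fix r :: real assume "0 < r"
    then obtain N where N: "inverse (real (Suc N)) < r" using reals_Archimedean by blast
    have "norm (G m i - F i) < r" if "N \<le> m" for m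
    proof -
      have "inverse (real (Suc m)) \<le> inverse (real (Suc N))"
        using that by (intro le_imp_inverse_le) auto
      then show ?thesis using G(2)[of m i] N unfolding real_norm_def by linarith
    qed
    then show "\<exists>no. \<forall>m\<ge>no. norm (G m i - F i) < r" by blast
  qed
  then have "limitin (product_topology (\<lambda>_. euclidean) UNIV) G F sequentially"
    by (simp add: limitin_componentwise)
  then have "G \<longlonglongrightarrow> F" by (simp add: euclidean_product_topology)
  then show ?thesis
    by (rule Lim_in_closed_set[OF closed_closure _ sequentially_bot, rotated])
      (use G(1) closure_subset in \<open>auto intro!: always_eventually\<close>)
qed

lemma continuous_on_phi: "continuous_on A (phi n)"
  unfolding phi_def
proof (rule continuous_on_coordinatewise_then_product)
  fix S :: "nat set"
  show "continuous_on A (\<lambda>p :: nat set \<Rightarrow> real. if S \<subseteq> {0..<n} then p (S \<union> {n..<n + (n - card S)}) else 0)"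
    by (cases "S \<subseteq> {0..<n}")
      (auto intro: continuous_on_subset[OF continuous_on_product_coordinates])
qed

section \<open>The equality before and after closure\<close>

context valued_field
begin

lemma nu_Gr_tropical_pluecker:
  assumes "p \<in> nu (Gr_idx n) val (Gr n)"
  shows "tropical_pluecker n p"
  unfolding tropical_pluecker_def
proof (intro allI impI)
  fix Z i j k l
  assume card: "Suc (Suc (card Z)) = n" and sub: "Z \<union> {i, j, k, l} \<subseteq> {0..<2*n}"
    and dist: "distinct [i, j, k, l]" and disj: "{i, j, k, l} \<inter> Z = {}"
  obtain x where x: "x \<in> Gr n" "\<And>C. C \<in> Gr_idx n \<Longrightarrow> x C \<noteq> 0"
    and p_eq: "p = (\<lambda>C. if C \<in> Gr_idx n then - val (x C) else 0)"
    using assms unfolding nu_def by blast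
  obtain M where M: "x = (\<lambda>C. if C \<in> Gr_idx n then minor n M C else 0)"
    using x(1) unfolding Gr_def by blast
  have nz: "minor n M C \<noteq> 0" if "C \<in> Gr_idx n" for C
    using x(2)[OF that] that unfolding M by simp
  have p: "p C = - val (minor n M C)" if "C \<in> Gr_idx n" for C
    using that unfolding p_eq M by simp
  have fin: "finite Z" using sub finite_subset by blast
  have idx: "insert u (insert v Z) \<in> Gr_idx n"
    if "u \<in> {i, j, k, l}" "v \<in> {i, j, k, l}" "u \<noteq> v" for u v
  proof -
    have "u \<notin> Z" "v \<notin> Z" "u < 2*n" "v < 2*n" using that disj sub by auto
    then show ?thesis using that(3) card fin sub by (simp add: Gr_idx_def)
  qed
  have "min (val (minor n M (insert i (insert k Z))) + val (minor n M (insert j (insert l Z))))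
      (val (minor n M (insert i (insert l Z))) + val (minor n M (insert j (insert k Z))))
    \<le> val (minor n M (insert i (insert j Z))) + val (minor n M (insert k (insert l Z)))"
    using val_three_term_pluecker[OF fin refl dist disj, of M] nz[OF idx] unfolding card by blast
  then show "p (insert i (insert j Z)) + p (insert k (insert l Z))
     \<le> max (p (insert i (insert k Z)) + p (insert j (insert l Z)))
           (p (insert i (insert l Z)) + p (insert j (insert k Z)))"
    using dist by (simp add: p[OF idx] min_def max_def split: if_splits)
qed

lemma phi_nu_Gr_in_nu_Fl:
  assumes "p \<in> nu (Gr_idx n) val (Gr n)"
  shows "phi n p \<in> nu (Pow {0..<n}) val (Fl n)"
proof -
  obtain x where x: "x \<in> Gr n" "\<And>C. C \<in> Gr_idx n \<Longrightarrow> x C \<noteq> 0"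
    and p: "p = (\<lambda>C. if C \<in> Gr_idx n then - val (x C) else 0)"
    using assms unfolding nu_def by blast
  let ?q = "\<lambda>S. if S \<subseteq> {0..<n} then x (S \<union> {n..<n + (n - card S)}) else 0"
  have "?q \<in> Fl n" using x by (rule Gr_imp_Fl)
  moreover have "\<forall>S\<in>Pow {0..<n}. ?q S \<noteq> 0" using x(2) completion_in_Gr_idx by simp
  moreover have "phi n p = (\<lambda>S. if S \<in> Pow {0..<n} then - val (?q S) else 0)"
    using completion_in_Gr_idx by (auto simp: phi_def p intro!: ext)
  ultimately show ?thesis by (rule nuI)
qed

text \<open>\<open>Fl_upper_triangular\<close> provides \<open>A\<close>, submodularity of
  \<open>F\<close> makes it a \<open>submodular_flag\<close>, and its generic extension realises
  \<open>psi n F\<close> up to the additive constant \<open>val (q {})\<close>.\<close>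

lemma psi_in_nu_Gr:
  assumes res: "infinite (residue_field val)" and n: "n > 0"
    and F: "F \<in> nu (Pow {0..<n}) val (Fl n)" "F \<in> SUBMOD n"
  shows "psi n F \<in> nu (Gr_idx n) val (Gr n)"
proof -
  obtain q where q: "q \<in> Fl n" "\<And>S. S \<subseteq> {0..<n} \<Longrightarrow> q S \<noteq> 0"
    and F_eq: "F = (\<lambda>S. if S \<in> Pow {0..<n} then - val (q S) else 0)"
    using F(1) unfolding nu_def by blast
  obtain A where A: "\<And>i j. i < n \<Longrightarrow> j < i \<Longrightarrow> A i j = 0"
    "\<And>S. S \<subseteq> {0..<n} \<Longrightarrow> q S = q {} * minor (card S) A S"
    by (rule Fl_upper_triangular[OF q]) blast+
  have minor_nz: "minor (card S) A S \<noteq> 0" if "S \<subseteq> {0..<n}" for S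
    using A(2)[OF that] q(2)[OF that] by auto
  have val_minor: "val (q S) = val (q {}) + val (minor (card S) A S)" if "S \<subseteq> {0..<n}" for S
    using A(2)[OF that] val_mult[of "q {}", OF _ minor_nz[OF that]] q(2)[of "{}"] by simp
  interpret submodular_flag val n A
  proof
    fix R x y
    assume R: "R \<subseteq> {0..<n}" and x: "x \<in> {0..<n} - R" and y: "y \<in> {0..<n} - R" and xy: "x \<noteq> (y::nat)"
    have fin: "finite R" using R finite_subset by blast
    have sub: "insert x R \<subseteq> {0..<n}" "insert y R \<subseteq> {0..<n}" "insert x (insert y R) \<subseteq> {0..<n}"
      using R x y by auto
    have card: "card (insert x R) = Suc (card R)" "card (insert y R) = Suc (card R)"
      "card (insert x (insert y R)) = Suc (Suc (card R))"
      using fin x y xy by auto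
    have "F (insert x R \<inter> insert y R) + F (insert x R \<union> insert y R) \<le> F (insert x R) + F (insert y R)"
      using F(2) sub(1,2) unfolding SUBMOD_def by blast
    moreover have "insert x R \<inter> insert y R = R" "insert x R \<union> insert y R = insert x (insert y R)"
      using x y xy by auto
    ultimately have "F R + F (insert x (insert y R)) \<le> F (insert x R) + F (insert y R)" by simp
    then have "val (q (insert x R)) + val (q (insert y R)) \<le> val (q R) + val (q (insert x (insert y R)))"
      using R sub unfolding F_eq by simp
    then show "val (minor (Suc (card R)) A (insert x R)) + val (minor (Suc (card R)) A (insert y R))
      \<le> val (minor (card R) A R) + val (minor (Suc (Suc (card R))) A (insert x (insert y R)))"
      using val_minor[OF R] val_minor[OF sub(1)] val_minor[OF sub(2)] val_minor[OF sub(3)]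
      unfolding card by simp
  qed (fact minor_nz A(1))+
  obtain N where N: "\<And>S T. S \<subseteq> {0..<n} \<Longrightarrow> T \<subseteq> {n..<2*n} \<Longrightarrow> card S + card T = n \<Longrightarrow>
    minor n N (S \<union> T) \<noteq> 0 \<and> val (minor n N (S \<union> T)) = val (minor (card S) A S)"
    by (rule ex_generic_extension[OF res]) blast
  \<comment> \<open>Scaling one row restores the factor \<open>q {}\<close> split off from
    \<open>A\<close>; row 0 exists because \<open>n > 0\<close>.\<close>
  define N' where "N' i c = (if i = 0 then q {} else 1) * N i c" for i c
  have N'_minor: "minor n N' C = q {} * minor n N C" for C
  proof -
    have "(\<Prod>i<n. N' i (cs ! s i)) = q {} * (\<Prod>i<n. N i (cs ! s i))" for cs :: "nat list" and s
      using n by (simp add: N'_def prod.distrib prod.delta)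
    then show ?thesis
      by (simp add: minor_def sum_distrib_left mult.left_commute)
  qed
  have "minor n N' C \<noteq> 0 \<and> psi n F C = - val (minor n N' C)" if C: "C \<in> Gr_idx n" for C
  proof -
    let ?S = "C \<inter> {0..<n}" and ?T = "C \<inter> {n..<2*n}"
    have C_eq: "C = ?S \<union> ?T" using C by (auto simp: Gr_idx_def)
    have "finite C" using C finite_subset by (auto simp: Gr_idx_def)
    then have "card (?S \<union> ?T) = card ?S + card ?T" by (intro card_Un_disjoint) auto
    then have "card ?S + card ?T = n" using C C_eq by (simp add: Gr_idx_def)
    then have "minor n N (?S \<union> ?T) \<noteq> 0 \<and> val (minor n N (?S \<union> ?T)) = val (minor (card ?S) A ?S)"
      by (intro N) auto
    then have "minor n N C \<noteq> 0" "val (minor n N C) = val (minor (card ?S) A ?S)"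
      using C_eq by simp_all
    moreover have "psi n F C = - val (q ?S)" using C by (simp add: psi_def F_eq)
    ultimately show ?thesis
      using q(2)[of "{}"] val_minor[of ?S] by (simp add: N'_minor val_mult)
  qed
  then show ?thesis
    unfolding nu_def Gr_def
    by (intro CollectI exI[of _ "\<lambda>C. if C \<in> Gr_idx n then minor n N' C else 0"])
      (auto simp: psi_def[of n F] intro!: ext)
qed

lemma phi_nu_Gr_eq:
  assumes "infinite (residue_field val)" "n > 0"
  shows "phi n ` (nu (Gr_idx n) val (Gr n) \<inter> Lspace n) = nu (Pow {0..<n}) val (Fl n) \<inter> SUBMOD n"
proof (intro equalityI subsetI)
  fix F assume "F \<in> phi n ` (nu (Gr_idx n) val (Gr n) \<inter> Lspace n)"
  then show "F \<in> nu (Pow {0..<n}) val (Fl n) \<inter> SUBMOD n"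
    using phi_nu_Gr_in_nu_Fl nu_Gr_tropical_pluecker tropical_pluecker_Lspace_imp_SUBMOD by blast
next
  fix F assume F: "F \<in> nu (Pow {0..<n}) val (Fl n) \<inter> SUBMOD n"
  then have "psi n F \<in> nu (Gr_idx n) val (Gr n) \<inter> Lspace n"
    using psi_in_nu_Gr[OF assms] psi_in_Lspace by blast
  moreover have "phi n (psi n F) = F" using F by (intro phi_psi nu_outside[of F]) auto
  ultimately show "F \<in> phi n ` (nu (Gr_idx n) val (Gr n) \<inter> Lspace n)" by force
qed

text \<open>Iterated square roots halve the valuation. A root of \<open>x\<close> or of
  \<open>- x\<close> is enough since \<open>val\<close> ignores signs, which treats algebraically
  closed and real closed fields alike.\<close>

lemma ex_small_val:
  assumes half: "\<And>x :: 'a. x \<noteq> 0 \<Longrightarrow> \<exists>y. y * y = x \<or> y * y = - x" and "\<delta> > 0"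
  obtains e where "e \<noteq> 0" "0 < val e" "val e < \<delta>"
proof -
  obtain x where x: "x \<noteq> 0" "val x > 0"
  proof -
    obtain x where "x \<noteq> 0" "val x \<noteq> 0" using val_nontrivial by blast
    then show thesis using that[of x] that[of "1 / x"] val_divide[of 1 x]
      by (cases "val x > 0") auto
  qed
  have "\<exists>y. y \<noteq> 0 \<and> val y = val x / 2 ^ m" for m
  proof (induction m)
    case 0
    then show ?case using x by auto
  next
    case (Suc m)
    then obtain y where y: "y \<noteq> 0" "val y = val x / 2 ^ m" by blast
    obtain z where z: "z * z = y \<or> z * z = - y" using half[OF y(1)] by blast
    then have "z \<noteq> 0" using y(1) by auto
    moreover have "2 * val z = val y" using z val_mult[OF \<open>z \<noteq> 0\<close> \<open>z \<noteq> 0\<close>] by auto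
    ultimately show ?case using y(2) by (intro exI[of _ z]) (simp add: field_simps)
  qed
  moreover obtain m where "val x / \<delta> < 2 ^ m"
    using real_arch_pow[of 2 "val x / \<delta>"] by auto
  then have "val x / 2 ^ m < \<delta>" using assms(2) by (simp add: field_simps)
  ultimately show thesis using that x(2) by (metis divide_pos_pos zero_less_numeral zero_less_power)
qed

text \<open>Adding a small multiple of the strictly submodular function \<open>\<lambda>S. - (card S)\<^sup>2\<close> makes an
  approximation of a submodular function submodular, and it only rescales the Pluecker
  vectors of the flag members.\<close>
lemma submodular_approximation:
  assumes half: "\<And>x :: 'a. x \<noteq> 0 \<Longrightarrow> \<exists>y. y * y = x \<or> y * y = - x"
    and F: "F \<in> closure (nu (Pow {0..<n}) val (Fl n))" "F \<in> SUBMOD n" and "\<delta> > 0"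
  obtains G where "G \<in> nu (Pow {0..<n}) val (Fl n)" "G \<in> SUBMOD n"
    "\<And>S. S \<subseteq> {0..<n} \<Longrightarrow> \<bar>G S - F S\<bar> < \<delta>"
proof -
  \<comment> \<open>The bound leaves room for at most \<open>real n ^ 2 * val e\<close> from the
    correction and less than \<open>val e / 2\<close> from the approximation.\<close>
  obtain e where e: "e \<noteq> 0" "0 < val e" "val e < \<delta> / (real n ^ 2 + 1)"
    by (rule ex_small_val[OF half, of "\<delta> / (real n ^ 2 + 1)"])
      (use \<open>\<delta> > 0\<close> in \<open>auto simp: add_nonneg_pos\<close>)
  obtain H where H: "H \<in> nu (Pow {0..<n}) val (Fl n)"
    "\<And>S. S \<in> Pow {0..<n} \<Longrightarrow> \<bar>H S - F S\<bar> < val e / 2"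
    by (rule closure_approachable_coordinates[OF F(1), of "Pow {0..<n}" "val e / 2"])
      (use e(2) in auto)
  obtain q where q: "q \<in> Fl n" "\<And>S. S \<subseteq> {0..<n} \<Longrightarrow> q S \<noteq> 0"
    and H_eq: "H = (\<lambda>S. if S \<in> Pow {0..<n} then - val (q S) else 0)"
    using H(1) unfolding nu_def by blast
  define q' where "q' S = e ^ (card S)\<^sup>2 * q S" for S
  define G where "G S = (if S \<in> Pow {0..<n} then - val (q' S) else 0)" for S
  have val_pow: "val (e ^ k) = real k * val e" for k
    by (induction k) (use e(1) in \<open>auto simp: val_mult algebra_simps\<close>)
  have G_eq: "G S = H S - real (card S) ^ 2 * val e" if "S \<subseteq> {0..<n}" for S
    using that q(2)[OF that] e(1) by (simp add: G_def H_eq q'_def val_mult val_pow)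
  have "q' \<in> Fl n"
  proof -
    obtain M c where c: "\<forall>k\<le>n. c k \<noteq> 0 \<and> rows_indep k n (M k)"
      and nested: "\<forall>k<n. row_span k n (M k) \<subseteq> row_span (Suc k) n (M (Suc k))"
      and q_eq: "q = (\<lambda>S. if S \<subseteq> {0..<n} then c (card S) * minor (card S) (M (card S)) S else 0)"
      using q(1) unfolding Fl_def by blast
    have "q' = (\<lambda>S. if S \<subseteq> {0..<n} then (e ^ (card S)\<^sup>2 * c (card S)) * minor (card S) (M (card S)) S else 0)"
      unfolding q'_def q_eq by (intro ext) simp
    then show ?thesis
      using c nested e(1) unfolding Fl_def
      by (intro CollectI exI[of _ M] exI[of _ "\<lambda>k. e ^ k\<^sup>2 * c k"]) simp
  qed
  moreover have "\<forall>S\<in>Pow {0..<n}. q' S \<noteq> 0" using q(2) e(1) by (simp add: q'_def)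
  moreover have "G = (\<lambda>S. if S \<in> Pow {0..<n} then - val (q' S) else 0)"
    unfolding G_def by (rule ext) simp
  ultimately have G: "G \<in> nu (Pow {0..<n}) val (Fl n)" unfolding nu_def by blast
  have "G (S \<inter> T) + G (S \<union> T) \<le> G S + G T" if S: "S \<subseteq> {0..<n}" and T: "T \<subseteq> {0..<n}" for S T
  proof (cases "S \<subseteq> T \<or> T \<subseteq> S")
    case True
    then show ?thesis by (auto simp: Int_absorb1 Int_absorb2 Un_absorb1 Un_absorb2)
  next
    case False
    have fin: "finite S" "finite T" using S T finite_subset by blast+
    define a b c where "a = real (card (S - T))" "b = real (card (T - S))" "c = real (card (S \<inter> T))"
    have "card (S - T) > 0" "card (T - S) > 0" using False fin by (auto simp: card_gt_0_iff)
    then have ab: "1 \<le> a" "1 \<le> b" by (simp_all add: a_b_c_def)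
    have cS: "real (card S) = a + c" and cT: "real (card T) = b + c"
      using card_Int_Diff[OF fin(1), of T] card_Int_Diff[OF fin(2), of S]
      by (simp_all add: a_b_c_def Int_commute)
    have "real (card S) + real (card T) = real (card (S \<union> T)) + real (card (S \<inter> T))"
      using card_Un_Int[OF fin] by linarith
    then have cU: "real (card (S \<union> T)) = a + b + c"
      unfolding cS cT by (simp add: a_b_c_def)
    have cI: "real (card (S \<inter> T)) = c" by (simp add: a_b_c_def)
    have sub: "S \<inter> T \<subseteq> {0..<n}" "S \<union> T \<subseteq> {0..<n}" using S T by auto
    have "F (S \<inter> T) + F (S \<union> T) \<le> F S + F T" using F(2) S T by (auto simp: SUBMOD_def)
    moreover have "\<bar>H S - F S\<bar> < val e / 2" "\<bar>H T - F T\<bar> < val e / 2"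
      "\<bar>H (S \<inter> T) - F (S \<inter> T)\<bar> < val e / 2" "\<bar>H (S \<union> T) - F (S \<union> T)\<bar> < val e / 2"
      using H(2) S T sub by auto
    ultimately have "H (S \<inter> T) + H (S \<union> T) \<le> H S + H T + 2 * val e" by linarith
    \<comment> \<open>The four approximation errors cost at most \<open>2 * val e\<close>;
      incomparable sets have \<open>a\<close> and \<open>b\<close> at least 1, so the correction
      gains no less.\<close>
    also have "2 * val e \<le> 2 * (a * b) * val e"
      using mult_mono[OF ab] ab e(2) by simp
    also have "2 * (a * b) * val e = (c\<^sup>2 + (a + b + c)\<^sup>2 - (a + c)\<^sup>2 - (b + c)\<^sup>2) * val e"
      by (simp add: power2_eq_square algebra_simps)
    finally show ?thesis
      unfolding G_eq[OF S] G_eq[OF T] G_eq[OF sub(1)] G_eq[OF sub(2)] cS cT cU cI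
      by (simp add: algebra_simps)
  qed
  then have "G \<in> SUBMOD n" by (simp add: SUBMOD_def)
  moreover have "\<bar>G S - F S\<bar> < \<delta>" if S: "S \<subseteq> {0..<n}" for S
  proof -
    have "card S \<le> n" using card_mono[OF _ S] by simp
    then have "real (card S) ^ 2 * val e \<le> real n ^ 2 * val e"
      using e(2) by (intro mult_right_mono power_mono) auto
    moreover have "0 \<le> real (card S) ^ 2 * val e" using e(2) by simp
    moreover have "\<bar>H S - F S\<bar> < val e / 2" using H(2) S by blast
    moreover have "val e * (real n ^ 2 + 1) < \<delta>"
    proof -
      have "0 < real n ^ 2 + 1" by (simp add: add_nonneg_pos)
      then show ?thesis using e(3) by (simp only: pos_less_divide_eq)
    qed
    then have le: "real n ^ 2 * val e + val e < \<delta>" by (simp add: algebra_simps)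
    ultimately show ?thesis using e(2) le unfolding G_eq[OF S] by linarith
  qed
  ultimately show thesis using G that by blast
qed

text \<open>Forward, \<open>phi n\<close> is continuous and the tropical relations are closed.
  Backward, \<open>submodular_approximation\<close> supplies points covered by
  \<open>psi_in_nu_Gr\<close>, and \<open>psi n\<close> preserves coordinatewise closeness.\<close>

lemma phi_trop_Gr_eq:
  assumes res: "infinite (residue_field val)" "n > 0"
    and half: "\<And>x :: 'a. x \<noteq> 0 \<Longrightarrow> \<exists>y. y * y = x \<or> y * y = - x"
  shows "phi n ` (trop (Gr_idx n) val (Gr n) \<inter> Lspace n) = trop (Pow {0..<n}) val (Fl n) \<inter> SUBMOD n"
  unfolding trop_def
proof (intro equalityI subsetI)
  fix F assume "F \<in> phi n ` (closure (nu (Gr_idx n) val (Gr n)) \<inter> Lspace n)"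
  then obtain p where p: "p \<in> closure (nu (Gr_idx n) val (Gr n))" "p \<in> Lspace n" "F = phi n p"
    by blast
  have "phi n ` closure (nu (Gr_idx n) val (Gr n)) \<subseteq> closure (nu (Pow {0..<n}) val (Fl n))"
    by (rule image_closure_subset[OF continuous_on_phi closed_closure])
      (use phi_nu_Gr_in_nu_Fl closure_subset in blast)
  then have "F \<in> closure (nu (Pow {0..<n}) val (Fl n))" using p by blast
  moreover have "closure (nu (Gr_idx n) val (Gr n)) \<subseteq> {p. tropical_pluecker n p}"
    by (rule closure_minimal[OF _ closed_tropical_pluecker]) (use nu_Gr_tropical_pluecker in blast)
  then have "F \<in> SUBMOD n" using p tropical_pluecker_Lspace_imp_SUBMOD by blast
  ultimately show "F \<in> closure (nu (Pow {0..<n}) val (Fl n)) \<inter> SUBMOD n" by blast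
next
  fix F assume "F \<in> closure (nu (Pow {0..<n}) val (Fl n)) \<inter> SUBMOD n"
  then have F: "F \<in> closure (nu (Pow {0..<n}) val (Fl n))" "F \<in> SUBMOD n" by blast+
  have "psi n F \<in> closure (nu (Gr_idx n) val (Gr n))"
  proof (rule in_closureI_coordinates)
    fix \<delta> :: real assume \<delta>: "\<delta> > 0"
    obtain G where G: "G \<in> nu (Pow {0..<n}) val (Fl n)" "G \<in> SUBMOD n"
      "\<And>S. S \<subseteq> {0..<n} \<Longrightarrow> \<bar>G S - F S\<bar> < \<delta>"
      by (rule submodular_approximation[OF half F \<delta>]) blast+
    have "psi n G \<in> nu (Gr_idx n) val (Gr n)" by (rule psi_in_nu_Gr[OF res G(1,2)])
    moreover have "\<bar>psi n G C - psi n F C\<bar> < \<delta>" for C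
      using G(3)[of "C \<inter> {0..<n}"] \<delta> by (simp add: psi_def)
    ultimately show "\<exists>G\<in>nu (Gr_idx n) val (Gr n). \<forall>C. \<bar>G C - psi n F C\<bar> < \<delta>" by blast
  qed
  moreover have "phi n (psi n F) = F"
    by (rule phi_psi, rule closure_nu_outside[OF F(1)]) simp
  ultimately show "F \<in> phi n ` (closure (nu (Gr_idx n) val (Gr n)) \<inter> Lspace n)"
    using psi_in_Lspace by force
qed

end

lemma alg_closed_ex_sqrt:
  assumes "alg_closed TYPE('a::field)"
  shows "\<exists>y :: 'a. y * y = x"
proof -
  have "degree [:- x, 0, 1:] > 0" by simp
  then obtain y where "poly [:- x, 0, 1:] y = 0" using assms unfolding alg_closed_def by blast
  then show ?thesis by (auto simp: algebra_simps)
qed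

text \<open>One of \<open>x\<close> and \<open>- x\<close> is nonnegative, hence a square.\<close>

lemma real_closed_ex_sqrt:
  fixes le :: "'a::field \<Rightarrow> 'a \<Rightarrow> bool"
  assumes "real_closed_wrt le"
  shows "\<exists>y :: 'a. y * y = x \<or> y * y = - x"
proof -
  have ord: "field_order le" and sqrt: "\<And>x. le 0 x \<Longrightarrow> \<exists>y. y * y = x"
    using assms unfolding real_closed_wrt_def by blast+
  have "le 0 x \<or> le x 0" using ord unfolding field_order_def by blast
  moreover have "le 0 (- x)" if "le x 0"
  proof -
    have "le (x + - x) (0 + - x)" using ord that unfolding field_order_def by blast
    then show ?thesis by simp
  qed
  ultimately show ?thesis using sqrt by blast
qed

theorem theorem3p2:
  fixes val :: "'a::field \<Rightarrow> real" and n :: nat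
  assumes "valuation val"
    and "has_splitting val"
    and "infinite (residue_field val)"
    and "n > 0"
  shows "phi n ` (nu (Gr_idx n) val (Gr n) \<inter> Lspace n)
           = nu (Pow {0..<n}) val (Fl n) \<inter> SUBMOD n
       \<and> ((alg_closed TYPE('a) \<or> (\<exists>le. real_closed_wrt le \<and> val_order_compatible le val))
          \<longrightarrow> phi n ` (trop (Gr_idx n) val (Gr n) \<inter> Lspace n)
              = trop (Pow {0..<n}) val (Fl n) \<inter> SUBMOD n)"
proof -
  interpret valued_field val using assms(1) by unfold_locales
  have "phi n ` (trop (Gr_idx n) val (Gr n) \<inter> Lspace n) = trop (Pow {0..<n}) val (Fl n) \<inter> SUBMOD n"
    if "alg_closed TYPE('a) \<or> (\<exists>le. real_closed_wrt le \<and> val_order_compatible le val)"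
  proof (rule phi_trop_Gr_eq[OF assms(3,4)])
    fix x :: 'a
    show "\<exists>y. y * y = x \<or> y * y = - x"
      using that alg_closed_ex_sqrt[of x] real_closed_ex_sqrt[of _ x] by blast
  qed
  with phi_nu_Gr_eq[OF assms(3,4)] show ?thesis by blast
qed

end
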